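(* Fix $\alpha\in\mathbb{R}$ with $\frac{1}{3}<\alpha<\frac{1}{2}$, and let $\Phi_\alpha:\mathbb{R}\to\mathbb{R}$ be given by $\Phi_\alpha(\xi)=|\xi|^\alpha$ for $\xi\in\mathbb{R}$. Then there exists a constant $C=C(\alpha)>0$ such that the estimate $$\lVert e^{it\Phi_\alpha(D)}\varphi\rVert_{L_x^\infty(\mathbb{R})}\leq C(1+|t|)^{-1/2}\Big(\lVert\varphi\rVert_{H_x^1(\mathbb{R})}+\lVert x\,\partial_x\varphi\rVert_{L_x^2(\mathbb{R})}\Big)$$ holds for all $t\in\mathbb{R}$ and all $\varphi\in \mathcal{S}(\mathbb{R})$.
   Context: $\mathcal{S}(\mathbb{R})$ is the Schwartz space of (complex-valued) functions on $\mathbb{R}$, $\partial_x=\frac{d}{dx}$, and $H_x^1(\mathbb{R})$ is the usual $L^2$-based Sobolev space of order one. $x\,\partial_x\varphi$ denotes the function $x\mapsto x\varphi'(x)$. The Fourier transform is $\widehat{f}(\xi)=\int_{\mathbb{R}}e^{-ix\xi}f(x)\,dx$ (up to a normalizing factor of $2\pi$, which only affects constants). The operator $e^{it\Phi_\alpha(D)}$ is the Fourier multiplier defined by $$\widehat{e^{it\Phi_\alpha(D)}\varphi}(\xi)=e^{it\Phi_\alpha(\xi)}\widehat{\varphi}(\xi),\qquad \varphi\in\mathcal{S}(\mathbb{R}).$$ *)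

theory Defs
  imports "HOL-Probability.Essential_Supremum"
begin

definition deriv_x :: "(real \<Rightarrow> complex) \<Rightarrow> real \<Rightarrow> complex" where
  "deriv_x f = (\<lambda>x. vector_derivative f (at x))"

definition schwartz :: "(real \<Rightarrow> complex) set" where
  "schwartz = {f. (\<forall>n x. (deriv_x ^^ n) f differentiable (at x)) \<and>
                  (\<forall>m n. bounded (range (\<lambda>x. x ^ m *\<^sub>R (deriv_x ^^ n) f x)))}"

definition fourier :: "(real \<Rightarrow> complex) \<Rightarrow> real \<Rightarrow> complex" where
  "fourier f = (\<lambda>\<xi>. LINT x|lborel. cis (- (x * \<xi>)) * f x)"

definition inverse_fourier :: "(real \<Rightarrow> complex) \<Rightarrow> real \<Rightarrow> complex" where
  "inverse_fourier g = (\<lambda>x. (1 / (2 * pi)) *\<^sub>R (LINT \<xi>|lborel. cis (x * \<xi>) * g \<xi>))"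

text \<open>The function whose Fourier transform is \<open>exp (i t \<Phi> \<xi>)\<close> times that of \<open>f\<close>. For real \<open>\<Phi>\<close>
  and Schwartz \<open>f\<close> this product is integrable when \<open>\<Phi>\<close> is measurable, so that the inversion
  integral converges absolutely.\<close>

definition propagator :: "(real \<Rightarrow> real) \<Rightarrow> real \<Rightarrow> (real \<Rightarrow> complex) \<Rightarrow> real \<Rightarrow> complex" where
  "propagator \<Phi> t f = inverse_fourier (\<lambda>\<xi>. cis (t * \<Phi> \<xi>) * fourier f \<xi>)"

definition Linf_norm :: "(real \<Rightarrow> complex) \<Rightarrow> ereal" where
  "Linf_norm f = esssup lborel (\<lambda>x. ereal (norm (f x)))"

text \<open>The next two real-valued norms are meaningful only where the integrals are finite, since a
  divergent Bochner integral is \<open>0\<close>; this holds for all Schwartz functions. The order-one Sobolev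
  norm uses the classical derivative, which for such functions is the weak one.\<close>

definition L2_norm :: "(real \<Rightarrow> complex) \<Rightarrow> real" where
  "L2_norm f = sqrt (LINT x|lborel. (norm (f x))\<^sup>2)"

definition H1_norm :: "(real \<Rightarrow> complex) \<Rightarrow> real" where
  "H1_norm f = sqrt ((L2_norm f)\<^sup>2 + (L2_norm (deriv_x f))\<^sup>2)"

end

theory Submission
  imports Defs "HOL-Probability.Probability"
begin

text \<open>On the Fourier side the norm on the right controls \<open>F\<close>, \<open>G\<close> and \<open>G'\<close> in \<open>L\<^sup>2\<close>, where \<open>F\<close> is the
  transform of \<open>\<phi>\<close> and \<open>G \<xi> = \<xi> F \<xi>\<close>. Let \<open>t \<ge> 1\<close> and consider \<open>\<xi> > 0\<close>; by Cauchy-Schwarz the parts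
  \<open>\<xi> < 1/t\<close> and \<open>\<xi> > t\<close> contribute \<open>O(t powr (-1/2))\<close>. Since \<open>G 0 = 0\<close>, \<open>\<bar>G \<xi>\<bar>\<close> is at most a constant
  times \<open>\<xi> powr (\<alpha>/2)\<close>, so the substitution \<open>u = \<xi> powr (\<alpha>/2)\<close> with \<open>\<beta> = 2/\<alpha>\<close> turns the remaining part
  into an oscillatory integral with phase \<open>P u = t u\<^sup>2 + x u powr \<beta>\<close> and bounded amplitude
  \<open>a u = G (u powr \<beta>) / u\<close>. Integration by parts with the weight \<open>P' / (P'\<^sup>2 + t)\<close> instead of \<open>1 / P'\<close> needs
  no excision of the stationary point, and all resulting integrals are of Lorentzian type. The term with
  \<open>G'\<close> has size \<open>t powr (-1/4 - 3\<alpha>/4)\<close>, which is where \<open>\<alpha> > 1/3\<close> enters.\<close>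

section \<open>Oscillatory integrals\<close>

text \<open>With \<open>D = y\<^sup>2 + t\<close>, the derivative of
  \<open>cis P * (y / D) * a\<close> reproduces \<open>cis P * a\<close> up to a factor of modulus
  one and a defect \<open>t / D\<close>. The weight \<open>y / D\<close> never exceeds
  \<open>1 / (2 * sqrt t)\<close> in modulus, even near zeros of \<open>y\<close>, so the two
  boundary values cost \<open>A / sqrt t\<close>. The three integrals come from the defect, the
  derivative of the weight and the derivative of the amplitude.\<close>

lemma regularized_ibp:
  fixes P y z :: "real \<Rightarrow> real" and a a' :: "real \<Rightarrow> complex"
  assumes le: "l \<le> r" and t: "t > 0"
    and P: "\<And>u. u \<in> {l..r} \<Longrightarrow> (P has_real_derivative y u) (at u)"
    and y: "\<And>u. u \<in> {l..r} \<Longrightarrow> (y has_real_derivative z u) (at u)"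
    and a: "\<And>u. u \<in> {l..r} \<Longrightarrow> (a has_vector_derivative a' u) (at u)"
    and cz: "continuous_on {l..r} z" and ca: "continuous_on {l..r} a'"
    and bd: "\<And>u. u \<in> {l..r} \<Longrightarrow> norm (a u) \<le> A"
  shows "norm (integral {l..r} (\<lambda>u. cis (P u) * a u))
     \<le> A / sqrt t + A * integral {l..r} (\<lambda>u. t / ((y u)\<^sup>2 + t))
       + A * integral {l..r} (\<lambda>u. \<bar>z u\<bar> / ((y u)\<^sup>2 + t))
       + integral {l..r} (\<lambda>u. norm (a' u) * (\<bar>y u\<bar> / ((y u)\<^sup>2 + t)))"
proof -
  define D where "D u = (y u)\<^sup>2 + t" for u
  have D: "D u > 0" for u using t by (simp add: D_def add_nonneg_pos)
  have Dn: "D u \<noteq> 0" for u using D[of u] by simp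
  have cP: "continuous_on {l..r} P" and cy: "continuous_on {l..r} y" and ca0: "continuous_on {l..r} a"
    using P y a
    by (meson DERIV_isCont has_vector_derivative_continuous continuous_at_imp_continuous_on)+
  have cD: "continuous_on {l..r} D" unfolding D_def by (intro continuous_intros cy)
  define R where "R u = (t / D u) *\<^sub>R a u + \<i> * ((z u * (t - (y u)\<^sup>2) / (D u)\<^sup>2) *\<^sub>R a u)
      + \<i> * ((y u / D u) *\<^sub>R a' u)" for u
  define W where "W u = cis (P u) * ((y u / D u) *\<^sub>R a u)" for u
  have W: "(W has_vector_derivative (\<i> * (cis (P u) * a u - cis (P u) * R u))) (at u within {l..r})"
    if u: "u \<in> {l..r}" for u
  proof -
    have q: "((\<lambda>u. y u / D u) has_real_derivative (z u * (t - (y u)\<^sup>2) / (D u)\<^sup>2)) (at u)"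
      using y[OF u] D[of u] unfolding D_def
      by (auto intro!: derivative_eq_intros simp: power2_eq_square field_simps)
    have c: "((\<lambda>u. cis (P u)) has_vector_derivative (y u *\<^sub>R (\<i> * cis (P u)))) (at u)"
      using has_derivative_cis[OF P[OF u, unfolded has_field_derivative_def]]
      by (simp add: has_vector_derivative_def mult.commute)
    have "(W has_vector_derivative (cis (P u) * ((y u / D u) *\<^sub>R a' u + (z u * (t - (y u)\<^sup>2) / (D u)\<^sup>2) *\<^sub>R a u)
       + (y u *\<^sub>R (\<i> * cis (P u))) * ((y u / D u) *\<^sub>R a u))) (at u)"
      unfolding W_def by (intro has_vector_derivative_mult c has_vector_derivative_scaleR q a[OF u])
    \<comment> \<open>Differentiating \<open>cis P\<close> produces a second factor
      \<open>y\<close>, and \<open>y * (y / D)\<close> falls short of 1 by exactly the Lorentzian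
      \<open>t / D\<close>.\<close>
    moreover have "(y u)\<^sup>2 / D u = 1 - t / D u" using D[of u] by (simp add: D_def field_simps)
    then have "(y u *\<^sub>R (\<i> * cis (P u))) * ((y u / D u) *\<^sub>R a u) = \<i> * cis (P u) * ((1 - t / D u) *\<^sub>R a u)"
      by (simp add: scaleR_conv_of_real power2_eq_square flip: of_real_mult of_real_divide)
    moreover have "c * (p *\<^sub>R b + q *\<^sub>R d) + \<i> * c * ((1 - s) *\<^sub>R d)
        = \<i> * (c * d - c * (s *\<^sub>R d + \<i> * (q *\<^sub>R d) + \<i> * (p *\<^sub>R b)))" for p q s :: real and b c d
      by (simp add: scaleR_conv_of_real algebra_simps)
    ultimately have "(W has_vector_derivative (\<i> * (cis (P u) * a u - cis (P u) * R u))) (at u)"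
      by (simp only: R_def)
    then show ?thesis by (rule has_vector_derivative_at_within)
  qed
  have cR: "continuous_on {l..r} R" unfolding R_def
    by (intro continuous_intros cy cz ca ca0 cD) (auto simp: Dn)
  have ii: "((\<lambda>u. \<i> * (cis (P u) * a u - cis (P u) * R u)) has_integral (W r - W l)) {l..r}"
    by (rule fundamental_theorem_of_calculus[OF le W])
  have i1: "(\<lambda>u. cis (P u) * a u) integrable_on {l..r}" and i2: "(\<lambda>u. cis (P u) * R u) integrable_on {l..r}"
    by (intro integrable_continuous_real continuous_intros cP ca0 cR)+
  have eq: "integral {l..r} (\<lambda>u. cis (P u) * a u) = integral {l..r} (\<lambda>u. cis (P u) * R u) - \<i> * (W r - W l)"
  proof -
    have "\<i> * (integral {l..r} (\<lambda>u. cis (P u) * a u) - integral {l..r} (\<lambda>u. cis (P u) * R u)) = W r - W l"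
      using integral_unique[OF ii] i1 i2 by (simp add: integral_diff)
    then have "\<i> * (\<i> * (integral {l..r} (\<lambda>u. cis (P u) * a u) - integral {l..r} (\<lambda>u. cis (P u) * R u))) = \<i> * (W r - W l)"
      by simp
    then show ?thesis by (simp add: algebra_simps flip: mult.assoc)
  qed
  \<comment> \<open>This is the arithmetic-geometric mean inequality
    \<open>2 * sqrt t * \<bar>y\<bar> \<le> y\<^sup>2 + t\<close>.\<close>
  have yD: "\<bar>y u\<bar> / D u \<le> 1 / (2 * sqrt t)" for u
  proof -
    have "0 \<le> (\<bar>y u\<bar> - sqrt t)\<^sup>2" by simp
    also have "\<dots> = D u - 2 * sqrt t * \<bar>y u\<bar>" using t by (simp add: D_def power2_diff)
    finally show ?thesis using D[of u] t by (simp add: field_simps)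
  qed
  have A0: "A \<ge> 0" using order_trans[OF norm_ge_zero bd[of l]] le by auto
  have nW: "norm (W u) \<le> A / (2 * sqrt t)" if "u \<in> {l..r}" for u
  proof -
    have "norm (W u) = (\<bar>y u\<bar> / D u) * norm (a u)" using D[of u] by (simp add: W_def norm_mult)
    also have "\<dots> \<le> 1 / (2 * sqrt t) * A"
      using yD bd[OF that] D[of u] t by (intro mult_mono) auto
    finally show ?thesis by simp
  qed
  define B where "B u = A * (t / D u) + A * (\<bar>z u\<bar> / D u) + norm (a' u) * (\<bar>y u\<bar> / D u)" for u
  have nR: "norm (cis (P u) * R u) \<le> B u" if u: "u \<in> {l..r}" for u
  proof -
    have "norm (R u) \<le> (t / D u) * norm (a u) + \<bar>z u * (t - (y u)\<^sup>2) / (D u)\<^sup>2\<bar> * norm (a u) + (\<bar>y u\<bar> / D u) * norm (a' u)"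
      unfolding R_def using D[of u] t
      by (intro order_trans[OF norm_triangle_ineq] add_mono) (auto simp: norm_mult)
    \<comment> \<open>In the derivative of the weight,
      \<open>\<bar>t - y\<^sup>2\<bar> \<le> D\<close> cancels one of the two factors
      \<open>D\<close>.\<close>
    moreover have "\<bar>z u * (t - (y u)\<^sup>2) / (D u)\<^sup>2\<bar> \<le> \<bar>z u\<bar> / D u"
    proof -
      have "\<bar>t - (y u)\<^sup>2\<bar> \<le> D u" using t by (simp add: D_def abs_le_iff) 
      then have "\<bar>z u\<bar> * \<bar>t - (y u)\<^sup>2\<bar> / (D u)\<^sup>2 \<le> \<bar>z u\<bar> * D u / (D u)\<^sup>2"
        by (intro divide_right_mono mult_left_mono) auto
      also have "\<dots> = \<bar>z u\<bar> / D u" using D[of u] by (simp add: power2_eq_square)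
      finally show ?thesis by (simp add: abs_mult)
    qed
    moreover have "(t / D u) * norm (a u) \<le> (t / D u) * A" "(\<bar>z u\<bar> / D u) * norm (a u) \<le> (\<bar>z u\<bar> / D u) * A"
      by (intro mult_left_mono bd[OF u] divide_nonneg_pos D; use t in simp)+
    moreover have "\<bar>z u * (t - (y u)\<^sup>2) / (D u)\<^sup>2\<bar> * norm (a u) \<le> \<bar>z u\<bar> / D u * norm (a u)"
      using calculation(2) by (rule mult_right_mono) simp
    ultimately show ?thesis by (simp add: norm_mult B_def mult.commute)
  qed
  have iB: "(\<lambda>u. t / D u) integrable_on {l..r}" "(\<lambda>u. \<bar>z u\<bar> / D u) integrable_on {l..r}"
     "(\<lambda>u. norm (a' u) * (\<bar>y u\<bar> / D u)) integrable_on {l..r}"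
    by (auto intro!: integrable_continuous_real continuous_intros cy cz ca ca0 cD simp: Dn)
  have hB: "(B has_integral (A * integral {l..r} (\<lambda>u. t / D u) + A * integral {l..r} (\<lambda>u. \<bar>z u\<bar> / D u)
       + integral {l..r} (\<lambda>u. norm (a' u) * (\<bar>y u\<bar> / D u)))) {l..r}"
    unfolding B_def[abs_def]
    by (intro has_integral_add has_integral_mult_right integrable_integral iB)
  have "norm (integral {l..r} (\<lambda>u. cis (P u) * R u)) \<le> integral {l..r} B"
    by (rule integral_norm_bound_integral[OF i2 has_integral_integrable[OF hB] nR])
  also note integral_unique[OF hB]
  finally have "norm (integral {l..r} (\<lambda>u. cis (P u) * R u))
      \<le> A * integral {l..r} (\<lambda>u. t / D u) + A * integral {l..r} (\<lambda>u. \<bar>z u\<bar> / D u)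
       + integral {l..r} (\<lambda>u. norm (a' u) * (\<bar>y u\<bar> / D u))" .
  moreover have "norm (\<i> * (W r - W l)) \<le> A / sqrt t"
    using nW[of r] nW[of l] le norm_triangle_ineq4[of "W r" "W l"] by (simp add: norm_mult)
  ultimately show ?thesis
    unfolding eq D_def[symmetric] using norm_triangle_ineq4[of "integral {l..r} (\<lambda>u. cis (P u) * R u)" "\<i> * (W r - W l)"]
    by linarith
qed

text \<open>The integrand is the derivative of \<open>arctan (y / sqrt t) / sqrt t\<close>. The
  bound therefore depends neither on the length of the interval nor on any monotonicity of
  \<open>y\<close>.\<close>

lemma integral_arctan_bound:
  fixes y z :: "real \<Rightarrow> real"
  assumes le: "l \<le> r" and t: "t > 0"
    and y: "\<And>u. u \<in> {l..r} \<Longrightarrow> (y has_real_derivative z u) (at u)"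
  shows "(\<lambda>u. z u / ((y u)\<^sup>2 + t)) integrable_on {l..r}"
    "\<bar>integral {l..r} (\<lambda>u. z u / ((y u)\<^sup>2 + t))\<bar> \<le> pi / sqrt t"
proof -
  have D: "(y u)\<^sup>2 + t > 0" for u using t by (simp add: add_nonneg_pos)
  have "((\<lambda>u. z u / ((y u)\<^sup>2 + t)) has_integral
      (arctan (y r / sqrt t) / sqrt t - arctan (y l / sqrt t) / sqrt t)) {l..r}"
  proof (rule fundamental_theorem_of_calculus[OF le])
    fix u assume u: "u \<in> {l..r}"
    have "1 + (y u / sqrt t)\<^sup>2 = ((y u)\<^sup>2 + t) / t" using t by (simp add: power_divide field_simps)
    then have "((\<lambda>u. arctan (y u / sqrt t) / sqrt t) has_real_derivative z u / ((y u)\<^sup>2 + t)) (at u)"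
      using t y[OF u] D[of u]
      by (auto intro!: derivative_eq_intros simp: divide_simps) (simp add: field_simps)
    then show "((\<lambda>u. arctan (y u / sqrt t) / sqrt t) has_vector_derivative z u / ((y u)\<^sup>2 + t)) (at u within {l..r})"
      by (simp add: has_real_derivative_iff_has_vector_derivative has_vector_derivative_at_within)
  qed
  note I = this
  show "(\<lambda>u. z u / ((y u)\<^sup>2 + t)) integrable_on {l..r}" using I by blast
  have "\<bar>arctan (y r / sqrt t) - arctan (y l / sqrt t)\<bar> \<le> pi"
    using arctan_bounded[of "y r / sqrt t"] arctan_bounded[of "y l / sqrt t"] by linarith
  then show "\<bar>integral {l..r} (\<lambda>u. z u / ((y u)\<^sup>2 + t))\<bar> \<le> pi / sqrt t"
    using t unfolding integral_unique[OF I] by (simp add: divide_simps flip: diff_divide_distrib)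
qed

text \<open>On \<open>u \<ge> 0\<close> the derivative of the phase vanishes only at 0 and, for
  \<open>x < 0\<close>, at one further point \<open>c\<close>. At each \<open>u > 0\<close> its
  modulus is at least \<open>t\<close> times the distance to one of these zeros, so its Lorentzian
  is dominated by two explicit ones whose integrals are bounded uniformly in \<open>x\<close>. For
  \<open>x \<ge> 0\<close> the witness is \<open>c = 0\<close>.\<close>

lemma phase_lorentz_bound:
  fixes t x \<beta> :: real
  assumes t: "t > 0" and b: "\<beta> \<ge> 3"
  obtains c where "\<And>u. u > 0 \<Longrightarrow> t / ((2 * t * u + x * \<beta> * u powr (\<beta> - 1))\<^sup>2 + t)
    \<le> t / ((t * u)\<^sup>2 + t) + t / ((t * (u - c))\<^sup>2 + t)"
proof -
  have key: "t / (Y\<^sup>2 + t) \<le> t / ((t * v)\<^sup>2 + t)" if "t * \<bar>v\<bar> \<le> \<bar>Y\<bar>" for Y v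
  proof -
    have "\<bar>t * v\<bar> \<le> \<bar>Y\<bar>" using that t by (simp add: abs_mult)
    then have "(t * v)\<^sup>2 \<le> Y\<^sup>2" by (simp only: abs_le_square_iff)
    then show ?thesis using t by (intro divide_left_mono mult_pos_pos add_nonneg_pos) auto
  qed
  have nn: "0 \<le> t / ((t * v)\<^sup>2 + t)" for v using t by simp
  show ?thesis
  proof (cases "x \<ge> 0")
    case True
    have "t / ((2 * t * u + x * \<beta> * u powr (\<beta> - 1))\<^sup>2 + t)
      \<le> t / ((t * u)\<^sup>2 + t) + t / ((t * (u - 0))\<^sup>2 + t)" if u: "u > 0" for u
    proof -
      have "0 \<le> x * \<beta> * u powr (\<beta> - 1)" using True b by simp
      moreover have "t * u > 0" using t u by simp
      ultimately have "t * \<bar>u\<bar> \<le> \<bar>2 * t * u + x * \<beta> * u powr (\<beta> - 1)\<bar>" using u by simp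
      from key[OF this] nn[of "u - 0"] show ?thesis by linarith
    qed
    then show ?thesis using that by blast
  next
    case False
    define k where "k = \<beta> - 2"
    have k: "k \<ge> 1" using b by (simp add: k_def)
    \<comment> \<open>This is the stationary point of the phase, the positive solution of
      \<open>2 * t + x * \<beta> * c powr k = 0\<close>; it allows the factorization
      \<open>2 * t * u * (1 - (u / c) powr k)\<close>.\<close>
    define c where "c = (2 * t / (- x * \<beta>)) powr (1 / k)"
    have pos: "2 * t / (- x * \<beta>) > 0" using False t b by (intro divide_pos_pos mult_pos_pos) auto
    have c: "c > 0" unfolding c_def powr_gt_zero using pos by (metis order.irrefl)
    have "(q powr (1 / k)) powr k = q" if "q > 0" for q using k that by (simp add: powr_powr)
    from this[OF pos] have "c powr k = 2 * t / (- x * \<beta>)" by (simp only: c_def)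
    then have ck: "x * \<beta> * c powr k = - 2 * t" using False b by simp
    have "t / ((2 * t * u + x * \<beta> * u powr (\<beta> - 1))\<^sup>2 + t)
      \<le> t / ((t * u)\<^sup>2 + t) + t / ((t * (u - c))\<^sup>2 + t)" if u: "u > 0" for u
    proof -
      define s where "s = u / c"
      have s: "s > 0" "u = s * c" using u c by (auto simp: s_def)
      have "u powr (\<beta> - 1) = u * (s powr k * c powr k)"
        using u s c powr_add[of u 1 k] by (simp add: k_def powr_mult)
      then have "x * \<beta> * u powr (\<beta> - 1) = u * s powr k * (x * \<beta> * c powr k)" by (simp add: mult_ac)
      then have Y: "2 * t * u + x * \<beta> * u powr (\<beta> - 1) = 2 * t * u * (1 - s powr k)"
        unfolding ck by (simp add: algebra_simps)
      \<comment> \<open>Raising \<open>s\<close> to a power \<open>k \<ge> 1\<close> moves it no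
        closer to 1, which is what \<open>\<beta> \<ge> 3\<close> provides.\<close>
      have "\<bar>1 - s\<bar> \<le> \<bar>1 - s powr k\<bar>"
      proof (cases "s \<le> 1")
        case True
        then have "s powr k \<le> s powr 1" using k s by (intro powr_mono') auto
        then show ?thesis using s True by simp
      next
        case False
        then have "s powr 1 \<le> s powr k" using k s by (intro powr_mono) auto
        then show ?thesis using s False by simp
      qed
      then have low: "2 * t * u * \<bar>1 - s\<bar> \<le> \<bar>2 * t * u + x * \<beta> * u powr (\<beta> - 1)\<bar>"
        using t u by (simp add: Y abs_mult)
      \<comment> \<open>For \<open>s \<le> 1 / 2\<close> the factor \<open>1 - s\<close> is at least
        one half and the Lorentzian at 0 suffices. Otherwise \<open>c \<le> 2 * u\<close>, and the
        one at \<open>c\<close> suffices.\<close>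
      show ?thesis
      proof (cases "s \<le> 1 / 2")
        case True
        then have "t * \<bar>u\<bar> \<le> 2 * t * u * \<bar>1 - s\<bar>" using t u by (simp add: field_simps)
        from key[OF order_trans[OF this low]] nn[of "u - c"] show ?thesis by linarith
      next
        case False
        have "t * \<bar>u - c\<bar> = t * c * \<bar>1 - s\<bar>" using s c by (simp add: abs_if algebra_simps)
        also have "\<dots> \<le> t * (2 * u) * \<bar>1 - s\<bar>"
          using False t c s by (intro mult_right_mono mult_left_mono) auto
        finally have "t * \<bar>u - c\<bar> \<le> 2 * t * u * \<bar>1 - s\<bar>" by simp
        from key[OF order_trans[OF this low]] nn[of u] show ?thesis by linarith
      qed
    qed
    then show ?thesis using that by blast
  qed
qed

text \<open>Here \<open>y\<close> and \<open>z\<close> are the first two derivatives of the phase.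
  The integral bounds are uniform in \<open>x\<close>, \<open>l\<close> and \<open>r\<close>, which
  is the source of the supremum over space. The last inequality lets a factor \<open>1 / u\<close>
  from the amplitude be absorbed into the two bounded integrals.\<close>

lemma phase_integral_bounds:
  fixes t x \<beta> l r :: real
  defines "y \<equiv> \<lambda>u. 2 * t * u + x * \<beta> * u powr (\<beta> - 1)"
  defines "z \<equiv> \<lambda>u. 2 * t + x * \<beta> * (\<beta> - 1) * u powr (\<beta> - 2)"
  assumes t: "t > 0" and b: "\<beta> \<ge> 3" and lr: "0 < l" "l \<le> r"
  shows "integral {l..r} (\<lambda>u. t / ((y u)\<^sup>2 + t)) \<le> 2 * (pi / sqrt t)"
    and "integral {l..r} (\<lambda>u. \<bar>z u\<bar> / ((y u)\<^sup>2 + t)) \<le> 9 * (pi / sqrt t)"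
    and "\<And>u. u > 0 \<Longrightarrow> (y has_real_derivative z u) (at u)"
    and "continuous_on {l..r} y" and "continuous_on {l..r} z"
    and "\<And>u. u > 0 \<Longrightarrow> \<bar>y u\<bar> / u \<le> \<bar>z u\<bar> + 2 * t"
proof -
  have D: "(y u)\<^sup>2 + t > 0" for u using t by (simp add: add_nonneg_pos)
  show dy: "(y has_real_derivative z u) (at u)" if "u > 0" for u
    unfolding y_def z_def using that by (auto intro!: derivative_eq_intros simp: algebra_simps)
  show cy: "continuous_on {l..r} y" and cz: "continuous_on {l..r} z"
    unfolding y_def z_def using lr by (auto intro!: continuous_intros)
  have Dn: "(y u)\<^sup>2 + t \<noteq> 0" for u using D[of u] by simp
  have it: "(\<lambda>u. t / ((y u)\<^sup>2 + t)) integrable_on {l..r}"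
    and iz: "(\<lambda>u. z u / ((y u)\<^sup>2 + t)) integrable_on {l..r}"
    and iaz: "(\<lambda>u. \<bar>z u\<bar> / ((y u)\<^sup>2 + t)) integrable_on {l..r}"
    by (auto intro!: integrable_continuous_real continuous_intros cy cz simp: Dn)
  obtain c where c: "\<And>u. u > 0 \<Longrightarrow> t / ((y u)\<^sup>2 + t) \<le> t / ((t * u)\<^sup>2 + t) + t / ((t * (u - c))\<^sup>2 + t)"
    using phase_lorentz_bound[OF t b, of x] unfolding y_def by blast
  \<comment> \<open>The linear function \<open>t * (u - d)\<close> has derivative \<open>t\<close>,
    so the arctangent bound covers both Lorentzians.\<close>
  have lin: "(\<lambda>u. t / ((t * (u - d))\<^sup>2 + t)) integrable_on {l..r}"
     "\<bar>integral {l..r} (\<lambda>u. t / ((t * (u - d))\<^sup>2 + t))\<bar> \<le> pi / sqrt t" for d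
    by (rule integral_arctan_bound[OF lr(2) t, where z = "\<lambda>_. t"];
        auto intro!: derivative_eq_intros)+
  have "integral {l..r} (\<lambda>u. t / ((y u)\<^sup>2 + t))
      \<le> integral {l..r} (\<lambda>u. t / ((t * (u - 0))\<^sup>2 + t) + t / ((t * (u - c))\<^sup>2 + t))"
    using lr c by (intro integral_le it integrable_add lin) auto
  also have "\<dots> = integral {l..r} (\<lambda>u. t / ((t * (u - 0))\<^sup>2 + t)) + integral {l..r} (\<lambda>u. t / ((t * (u - c))\<^sup>2 + t))"
    by (rule integral_add[OF lin(1) lin(1)])
  finally show T1: "integral {l..r} (\<lambda>u. t / ((y u)\<^sup>2 + t)) \<le> 2 * (pi / sqrt t)"
    using lin(2)[of 0] lin(2)[of c] by linarith
  define \<sigma> :: real where "\<sigma> = (if x \<ge> 0 then 1 else - 1)"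
  \<comment> \<open>\<open>z \<ge> 0\<close> for \<open>x \<ge> 0\<close> and \<open>z \<le> 2 t\<close> for \<open>x < 0\<close>; this avoids splitting at the zero of \<open>z\<close>, since
    \<open>z / (y\<^sup>2 + t)\<close> integrates to an arctangent.\<close>
  have zb: "\<bar>z u\<bar> \<le> 4 * t + \<sigma> * z u" if "u > 0" for u
  proof (cases "x \<ge> 0")
    case True
    then have "0 \<le> x * \<beta> * (\<beta> - 1) * u powr (\<beta> - 2)" using b by simp
    then show ?thesis using t True by (simp add: z_def \<sigma>_def)
  next
    case False
    then have "x * (\<beta> * (\<beta> - 1) * u powr (\<beta> - 2)) \<le> 0" using b by (intro mult_nonpos_nonneg) auto
    then show ?thesis using t False by (simp add: z_def \<sigma>_def mult.assoc)
  qed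
  have "integral {l..r} (\<lambda>u. \<bar>z u\<bar> / ((y u)\<^sup>2 + t))
      \<le> integral {l..r} (\<lambda>u. 4 * (t / ((y u)\<^sup>2 + t)) + \<sigma> * (z u / ((y u)\<^sup>2 + t)))"
  proof (intro integral_le iaz integrable_add integrable_on_mult_right it iz)
    fix u assume "u \<in> {l..r}"
    then have "\<bar>z u\<bar> / ((y u)\<^sup>2 + t) \<le> (4 * t + \<sigma> * z u) / ((y u)\<^sup>2 + t)"
      using zb[of u] lr D[of u] by (intro divide_right_mono) auto
    then show "\<bar>z u\<bar> / ((y u)\<^sup>2 + t) \<le> 4 * (t / ((y u)\<^sup>2 + t)) + \<sigma> * (z u / ((y u)\<^sup>2 + t))"
      by (simp add: add_divide_distrib)
  qed
  also have "\<dots> = 4 * integral {l..r} (\<lambda>u. t / ((y u)\<^sup>2 + t)) + \<sigma> * integral {l..r} (\<lambda>u. z u / ((y u)\<^sup>2 + t))"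
    by (simp only: integral_add[OF integrable_on_mult_right[OF it] integrable_on_mult_right[OF iz]]
        integral_mult_right)
  \<comment> \<open>The constant 9 arises as \<open>4 * 2 + 1\<close>, the last summand being the
    arctangent bound for the signed integral.\<close>
  also have "\<dots> \<le> 4 * (2 * (pi / sqrt t)) + pi / sqrt t"
    using T1 integral_arctan_bound(2)[OF lr(2) t dy] lr unfolding \<sigma>_def by (auto split: if_splits)
  finally show "integral {l..r} (\<lambda>u. \<bar>z u\<bar> / ((y u)\<^sup>2 + t)) \<le> 9 * (pi / sqrt t)" by simp
  show "\<bar>y u\<bar> / u \<le> \<bar>z u\<bar> + 2 * t" if u: "u > 0" for u
  proof -
    define w where "w = x * \<beta> * u powr (\<beta> - 2)"
    have "u powr (\<beta> - 1) = u * u powr (\<beta> - 2)"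
      using u powr_add[of u 1 "\<beta> - 2"] by simp
    then have "y u = u * (2 * t + w)" by (simp add: y_def w_def algebra_simps)
    then have "\<bar>y u\<bar> / u = \<bar>2 * t + w\<bar>" using u by (simp add: abs_mult)
    moreover have "z u = 2 * t + (\<beta> - 1) * w" by (simp add: z_def w_def)
    \<comment> \<open>For \<open>w < 0\<close> there are two possibilities: if
      \<open>2 * t + w \<ge> 0\<close>, the left side is at most \<open>2 * t\<close>; otherwise
      \<open>2 * t + (\<beta> - 1) * w\<close> is negative too and larger in modulus.\<close>
    moreover have "\<bar>2 * t + w\<bar> \<le> \<bar>2 * t + (\<beta> - 1) * w\<bar> + 2 * t"
    proof (cases "w \<ge> 0")
      case True
      then have "w \<le> (\<beta> - 1) * w" using b mult_right_mono[of 1 "\<beta> - 1" w] by simp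
      then show ?thesis using True t by simp
    next
      case False
      then have "(\<beta> - 1) * w \<le> 1 * w" using b by (intro mult_right_mono_neg) auto
      then show ?thesis using False t by linarith
    qed
    ultimately show ?thesis by simp
  qed
qed

text \<open>Differentiating the amplitude gives a term of size \<open>M / u\<close>, absorbed
  through the bound on \<open>\<bar>y\<bar> / u\<close>, and a term with \<open>G1\<close>, which is
  controlled only in the square mean. The latter is paired with \<open>\<bar>y\<bar> / D\<close> by
  weighted squares; a power of \<open>u\<close> is left over, which
  \<open>u powr \<beta> \<le> t\<close> and \<open>\<beta> \<le> 6\<close> keep below
  \<open>sqrt t\<close>.\<close>

lemma oscillatory_core:
  fixes G G1 :: "real \<Rightarrow> complex" and t x \<beta> l r K M :: real
  assumes t: "t \<ge> 1" and b: "3 \<le> \<beta>" "\<beta> \<le> 6" and lr: "0 < l" "l \<le> r" and rt: "r powr \<beta> \<le> t"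
    and G: "\<And>s. s > 0 \<Longrightarrow> (G has_vector_derivative G1 s) (at s)"
    and G1: "continuous_on {0<..} G1"
    and M: "\<And>u. u \<in> {l..r} \<Longrightarrow> norm (G (u powr \<beta>)) \<le> M * u"
    and K: "K > 0" "integral {l powr \<beta>..r powr \<beta>} (\<lambda>s. (norm (G1 s))\<^sup>2) \<le> K\<^sup>2"
  shows "norm (integral {l..r} (\<lambda>u. cis (t * u\<^sup>2 + x * u powr \<beta>) * ((1 / u) *\<^sub>R G (u powr \<beta>))))
    \<le> (M * (1 + 24 * pi) + K * (1 + 6 * pi)) / sqrt t"
proof -
  define y where "y = (\<lambda>u. 2 * t * u + x * \<beta> * u powr (\<beta> - 1))"
  define z where "z = (\<lambda>u. 2 * t + x * \<beta> * (\<beta> - 1) * u powr (\<beta> - 2))"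
  have t0: "t > 0" using t by simp
  note pb = phase_integral_bounds[OF t0 b(1) lr, where x = x, folded y_def z_def]
  have dy: "(y has_real_derivative z u) (at u)" if "u > 0" for u
    using pb(3)[OF that] by (simp add: z_def)
  have yu: "\<bar>y u\<bar> / u \<le> \<bar>z u\<bar> + 2 * t" if "u > 0" for u
    using pb(6)[OF that] by (simp add: y_def z_def)
  define D where "D u = (y u)\<^sup>2 + t" for u
  have D: "D u > 0" for u using t by (simp add: D_def add_nonneg_pos)
  have Dn: "D u \<noteq> 0" for u using D[of u] by simp
  have cD: "continuous_on {l..r} D" unfolding D_def by (intro continuous_intros pb)
  define a where "a u = (1 / u) *\<^sub>R G (u powr \<beta>)" for u
  define H where "H u = (\<beta> * u powr (\<beta> - 2)) *\<^sub>R G1 (u powr \<beta>)" for u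
  define a' where "a' u = H u - (1 / u\<^sup>2) *\<^sub>R G (u powr \<beta>)" for u
  have dp: "((\<lambda>u. u powr \<beta>) has_real_derivative \<beta> * u powr (\<beta> - 1)) (at u)" if "u > 0" for u
    using that by (auto intro!: derivative_eq_intros)
  have dG: "((\<lambda>u. G (u powr \<beta>)) has_vector_derivative (\<beta> * u powr (\<beta> - 1)) *\<^sub>R G1 (u powr \<beta>)) (at u)"
    if u: "u > 0" for u
    using vector_diff_chain_at[OF dp[OF u, unfolded has_real_derivative_iff_has_vector_derivative] G] u
    by (simp add: o_def)
  have da: "(a has_vector_derivative a' u) (at u)" if u: "u > 0" for u
  proof -
    have "((\<lambda>u. 1 / u) has_real_derivative (- (1 / u\<^sup>2))) (at u)"
      using u by (auto intro!: derivative_eq_intros simp: power2_eq_square)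
    from has_vector_derivative_scaleR[OF this dG[OF u]]
    have "(a has_vector_derivative (1 / u) *\<^sub>R (\<beta> * u powr (\<beta> - 1)) *\<^sub>R G1 (u powr \<beta>)
        + (- (1 / u\<^sup>2)) *\<^sub>R G (u powr \<beta>)) (at u)"
      by (simp add: a_def[abs_def])
    moreover have "u powr (\<beta> - 1) = u * u powr (\<beta> - 2)"
      using u powr_add[of u 1 "\<beta> - 2"] by simp
    ultimately show ?thesis using u by (simp add: a'_def H_def)
  qed
  have cpow: "continuous_on {l..r} (\<lambda>u. u powr c)" for c using lr by (auto intro!: continuous_intros)
  have cG1: "continuous_on {l..r} (\<lambda>u. G1 (u powr \<beta>))"
    by (rule continuous_on_compose2[OF G1 cpow]) (use lr in auto)
  have cG: "continuous_on {l..r} (\<lambda>u. G (u powr \<beta>))"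
    using lr by (intro continuous_at_imp_continuous_on ballI) (auto intro!: has_vector_derivative_continuous[OF dG])
  have cH: "continuous_on {l..r} H" unfolding H_def by (intro continuous_intros cpow cG1)
  have ca': "continuous_on {l..r} a'" unfolding a'_def
    using lr by (intro continuous_intros cH cG) auto
  have bd: "norm (a u) \<le> M" if u: "u \<in> {l..r}" for u
    using M[OF u] u lr by (simp add: a_def field_simps)
  have M0: "M \<ge> 0" using order_trans[OF norm_ge_zero bd[of l]] lr by auto
  have dP: "((\<lambda>u. t * u\<^sup>2 + x * u powr \<beta>) has_real_derivative y u) (at u)" if "u > 0" for u
    unfolding y_def using that by (auto intro!: derivative_eq_intros simp: algebra_simps)
  have ibp: "norm (integral {l..r} (\<lambda>u. cis (t * u\<^sup>2 + x * u powr \<beta>) * a u))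
     \<le> M / sqrt t + M * integral {l..r} (\<lambda>u. t / D u) + M * integral {l..r} (\<lambda>u. \<bar>z u\<bar> / D u)
       + integral {l..r} (\<lambda>u. norm (a' u) * (\<bar>y u\<bar> / D u))"
    unfolding D_def
    by (rule regularized_ibp[OF lr(2) t0]) (use lr dP dy da pb(5) ca' bd in auto)
  \<comment> \<open>The Jacobian of \<open>s = u powr \<beta>\<close> is built into
    \<open>e\<close>, so that its integral is exactly that of \<open>(norm (G1 s))\<^sup>2\<close>
    over the image interval.\<close>
  define e where "e u = (\<beta> * u powr (\<beta> - 1)) * (norm (G1 (u powr \<beta>)))\<^sup>2" for u
  have ie: "(e has_integral integral {l powr \<beta>..r powr \<beta>} (\<lambda>s. (norm (G1 s))\<^sup>2)) {l..r}"
  proof -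
    have "((\<lambda>u. (\<beta> * u powr (\<beta> - 1)) *\<^sub>R (norm (G1 (u powr \<beta>)))\<^sup>2) has_integral
        integral {l powr \<beta>..r powr \<beta>} (\<lambda>s. (norm (G1 s))\<^sup>2)) {l..r}"
    proof (rule has_integral_substitution[where c = "l powr \<beta>" and d = "r powr \<beta>"])
      show "continuous_on {l powr \<beta>..r powr \<beta>} (\<lambda>s. (norm (G1 s))\<^sup>2)"
        using lr by (intro continuous_intros continuous_on_subset[OF G1]) (auto intro: less_le_trans[of 0 "l powr \<beta>"])
      show "((\<lambda>u. u powr \<beta>) has_real_derivative \<beta> * u powr (\<beta> - 1)) (at u within {l..r})" if "u \<in> {l..r}" for u
        using that lr by (auto intro: has_field_derivative_at_within[OF dp])
      show "(\<lambda>u. u powr \<beta>) ` {l..r} \<subseteq> {l powr \<beta>..r powr \<beta>}" "l powr \<beta> \<le> r powr \<beta>"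
        using lr b by (auto intro!: powr_mono2)
    qed (rule lr)
    then show ?thesis by (simp add: e_def[abs_def])
  qed
  have it: "(\<lambda>u. t / D u) integrable_on {l..r}" and iz: "(\<lambda>u. \<bar>z u\<bar> / D u) integrable_on {l..r}"
    and ia: "(\<lambda>u. norm (a' u) * (\<bar>y u\<bar> / D u)) integrable_on {l..r}"
    by (auto intro!: integrable_continuous_real continuous_intros cD pb ca' simp: Dn)
  \<comment> \<open>The first two terms majorize the contribution of \<open>G1\<close>, the last two
    the contribution of differentiating \<open>1 / u\<close>.\<close>
  define B where "B u = (1 / (2 * sqrt t * K)) * e u + (\<beta> * K / 2) * (t / D u)
    + (M * (\<bar>z u\<bar> / D u) + (2 * M) * (t / D u))" for u
  have pw: "norm (a' u) * (\<bar>y u\<bar> / D u) \<le> B u" if u: "u \<in> {l..r}" for u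
  proof -
    have u0: "u > 0" using u lr by simp
    define p where "p = norm (G1 (u powr \<beta>))"
    define q where "q = \<bar>y u\<bar> / D u"
    have q0: "q \<ge> 0" using D[of u] by (simp add: q_def)
    \<comment> \<open>Since \<open>y\<^sup>2 \<le> D\<close>, the square of \<open>q\<close> is at
      most \<open>1 / D\<close>, again a Lorentzian.\<close>
    have q2: "q\<^sup>2 \<le> (t / D u) / t"
    proof -
      have "(y u)\<^sup>2 / (D u)\<^sup>2 \<le> D u / (D u)\<^sup>2" using t by (intro divide_right_mono) (auto simp: D_def)
      then show ?thesis using D[of u] t by (simp add: q_def power_divide power2_eq_square)
    qed
    have "norm (a' u) \<le> \<beta> * u powr (\<beta> - 2) * p + (1 / u\<^sup>2) * norm (G (u powr \<beta>))"
      unfolding a'_def H_def p_def using b by (intro order_trans[OF norm_triangle_ineq4]) simp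
    also have "(1 / u\<^sup>2) * norm (G (u powr \<beta>)) \<le> (1 / u\<^sup>2) * (M * u)"
      using M[OF u] by (intro mult_left_mono) auto
    also have "\<dots> = M / u" using u0 by (simp add: power2_eq_square)
    finally have "norm (a' u) \<le> \<beta> * u powr (\<beta> - 2) * p + M / u" by simp
    from mult_right_mono[OF this q0] have "norm (a' u) * q \<le> \<beta> * u powr (\<beta> - 2) * p * q + M / u * q"
      by (simp only: distrib_right)
    moreover have "M / u * q \<le> M * (\<bar>z u\<bar> / D u) + (2 * M) * (t / D u)"
    proof -
      have "M / u * q = M * ((\<bar>y u\<bar> / u) / D u)" by (simp add: q_def)
      also have "\<dots> \<le> M * ((\<bar>z u\<bar> + 2 * t) / D u)"
        using yu[OF u0] M0 D[of u] by (intro mult_left_mono divide_right_mono) auto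
      finally show ?thesis by (simp add: add_divide_distrib distrib_left mult.left_commute mult.commute mult.assoc)
    qed
    moreover have "\<beta> * u powr (\<beta> - 2) * p * q \<le> (1 / (2 * sqrt t * K)) * e u + (\<beta> * K / 2) * (t / D u)"
    proof -
      \<comment> \<open>The power \<open>u powr (\<beta> - 2)\<close> is split as
        \<open>u * v\<^sup>2\<close>. The factor \<open>u\<close> joins \<open>p\<close>, because
        \<open>\<beta> * v\<^sup>2 * (u * p)\<^sup>2\<close> is the density \<open>e\<close>, and
        only \<open>v\<^sup>2\<close> has to be estimated.\<close>
      define v where "v = u powr ((\<beta> - 3) / 2)"
      have v1: "u powr (\<beta> - 2) = u * v * v" and v2: "u powr (\<beta> - 1) = (u * u) * (v * v)"
        using powr_add[of u "(\<beta> - 3) / 2" "(\<beta> - 3) / 2"] powr_add[of u "\<beta> - 3" 1]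
          powr_add[of u "\<beta> - 3" 2] u0
        by (simp_all add: v_def power2_eq_square)
      have vt: "v\<^sup>2 \<le> sqrt t"
      proof -
        have "v\<^sup>2 = u powr (\<beta> - 3)"
          using powr_add[of u "(\<beta> - 3) / 2" "(\<beta> - 3) / 2"] by (simp add: v_def power2_eq_square)
        also have "\<dots> \<le> r powr (\<beta> - 3)" using u u0 b by (intro powr_mono2) auto
        also have "\<dots> = (r powr \<beta>) powr ((\<beta> - 3) / \<beta>)" using b by (simp add: powr_powr)
        also have "\<dots> \<le> t powr ((\<beta> - 3) / \<beta>)" using rt b by (intro powr_mono2) auto
        \<comment> \<open>The comparison of exponents
          \<open>(\<beta> - 3) / \<beta> \<le> 1 / 2\<close> amounts to
          \<open>\<beta> \<le> 6\<close>, that is \<open>\<alpha> \<ge> 1 / 3\<close> when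
          \<open>\<beta> = 2 / \<alpha>\<close>.\<close>
        also have "\<dots> \<le> t powr (1 / 2)" using t b by (intro powr_mono) (auto simp: field_simps)
        finally show ?thesis using t by (simp add: powr_half_sqrt)
      qed
      define s where "s = sqrt t"
      have s: "s > 0" "s * s = t" using t by (auto simp: s_def)
      \<comment> \<open>The weight \<open>s * K\<close> balances the squares: after integration each
        contributes a multiple of \<open>K / sqrt t\<close>.\<close>
      have "0 \<le> (u * p - s * K * q)\<^sup>2" by simp
      then have "2 * (u * p * q) * (s * K) \<le> (u * p)\<^sup>2 + (s * K * q)\<^sup>2"
        by (simp add: power2_diff algebra_simps)
      then have "u * p * q \<le> ((u * p)\<^sup>2 + (s * K * q)\<^sup>2) / (2 * s * K)"
        using s K by (simp add: field_simps)
      also have "\<dots> = (u * p)\<^sup>2 / (2 * s * K) + s * K * q\<^sup>2 / 2"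
        using s K by (simp add: add_divide_distrib power2_eq_square)
      finally have "(\<beta> * v\<^sup>2) * (u * p * q) \<le> (\<beta> * v\<^sup>2) * ((u * p)\<^sup>2 / (2 * s * K) + s * K * q\<^sup>2 / 2)"
        using b by (intro mult_left_mono) auto
      also have "\<dots> = (1 / (2 * s * K)) * e u + \<beta> * (s * K / 2) * (v\<^sup>2 * q\<^sup>2)"
        by (simp add: e_def v2 p_def power2_eq_square algebra_simps)
      also have "v\<^sup>2 * q\<^sup>2 \<le> s * ((t / D u) / t)"
        using vt q2 s by (intro mult_mono) (auto simp: s_def)
      then have "\<beta> * (s * K / 2) * (v\<^sup>2 * q\<^sup>2) \<le> \<beta> * (s * K / 2) * (s * ((t / D u) / t))"
        using b s K by (intro mult_left_mono) auto
      also have "\<beta> * (s * K / 2) * (s * ((t / D u) / t)) = (\<beta> * K / 2) * ((s * s) * ((t / D u) / t))"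
        by (simp add: mult_ac)
      also have "(s * s) * ((t / D u) / t) = t / D u" using t s by simp
      finally show ?thesis by (simp add: s_def v1 power2_eq_square mult_ac)
    qed
    ultimately show ?thesis by (simp add: B_def q_def)
  qed
  have iB: "(B has_integral ((1 / (2 * sqrt t * K)) * integral {l powr \<beta>..r powr \<beta>} (\<lambda>s. (norm (G1 s))\<^sup>2)
     + (\<beta> * K / 2) * integral {l..r} (\<lambda>u. t / D u)
     + (M * integral {l..r} (\<lambda>u. \<bar>z u\<bar> / D u) + (2 * M) * integral {l..r} (\<lambda>u. t / D u)))) {l..r}"
    unfolding B_def[abs_def]
    by (intro has_integral_add has_integral_mult_right ie integrable_integral it iz)
  have T1: "integral {l..r} (\<lambda>u. t / D u) \<le> 2 * pi / sqrt t"
    and T3: "integral {l..r} (\<lambda>u. \<bar>z u\<bar> / D u) \<le> 9 * pi / sqrt t"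
    using pb(1,2) by (simp_all add: D_def y_def z_def)
  have nn: "integral {l..r} (\<lambda>u. t / D u) \<ge> 0" "integral {l..r} (\<lambda>u. \<bar>z u\<bar> / D u) \<ge> 0"
    using t D by (auto intro!: integral_nonneg it iz simp: less_imp_le)
  have "integral {l..r} (\<lambda>u. norm (a' u) * (\<bar>y u\<bar> / D u)) \<le> integral {l..r} B"
    by (intro integral_le ia has_integral_integrable[OF iB] pw)
  also have "\<dots> \<le> (1 / (2 * sqrt t * K)) * K\<^sup>2 + (6 * K / 2) * (2 * pi / sqrt t)
     + (M * (9 * pi / sqrt t) + (2 * M) * (2 * pi / sqrt t))"
    unfolding integral_unique[OF iB]
  proof (intro add_mono mult_mono T1 T3 K(2) nn)
    show "0 \<le> integral {l powr \<beta>..r powr \<beta>} (\<lambda>s. (norm (G1 s))\<^sup>2)"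
      using lr by (intro integral_nonneg integrable_continuous_real continuous_intros continuous_on_subset[OF G1])
         (auto intro: less_le_trans[of 0 "l powr \<beta>"])
  qed (use b K M0 t in auto)
  finally have "integral {l..r} (\<lambda>u. norm (a' u) * (\<bar>y u\<bar> / D u))
     \<le> (K / 2 + 6 * pi * K + 13 * pi * M) / sqrt t"
    using K by (simp add: power2_eq_square add_divide_distrib mult_ac)
  moreover have "M * integral {l..r} (\<lambda>u. t / D u) \<le> M * (2 * pi / sqrt t)"
    "M * integral {l..r} (\<lambda>u. \<bar>z u\<bar> / D u) \<le> M * (9 * pi / sqrt t)"
    by (intro mult_left_mono T1 T3 M0)+
  ultimately have "norm (integral {l..r} (\<lambda>u. cis (t * u\<^sup>2 + x * u powr \<beta>) * a u)) \<le>
     M / sqrt t + M * (2 * pi / sqrt t) + M * (9 * pi / sqrt t) + (K / 2 + 6 * pi * K + 13 * pi * M) / sqrt t"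
    using ibp by linarith
  also have "\<dots> = (M * (1 + 24 * pi) + K * (1 / 2 + 6 * pi)) / sqrt t"
    by (simp add: add_divide_distrib distrib_left mult_ac)
  also have "\<dots> \<le> (M * (1 + 24 * pi) + K * (1 + 6 * pi)) / sqrt t"
    using K t by (auto intro!: divide_right_mono)
  finally show ?thesis by (simp add: a_def)
qed

section \<open>The dispersive estimate on the Fourier side\<close>

lemma two_mult_le_weighted_squares:
  fixes p q c :: real
  assumes "c > 0"
  shows "p * q \<le> (p\<^sup>2 / c + c * q\<^sup>2) / 2"
proof -
  have "0 \<le> (p - c * q)\<^sup>2 / c" using assms by simp
  also have "\<dots> = p\<^sup>2 / c + c * q\<^sup>2 - 2 * p * q" using assms by (simp add: power2_eq_square field_simps)
  finally show ?thesis by simp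
qed

lemma has_bochner_integral_inverse_one_plus_square:
  "has_bochner_integral lborel (\<lambda>x::real. 1 / (1 + x\<^sup>2)) pi"
  using integrable_inverse_1_plus_square LBINT_inverse_1_plus_square
  by (simp add: has_bochner_integral_iff set_integrable_def interval_lebesgue_integral_def
      set_lebesgue_integral_def einterval_eq inverse_eq_divide)

lemma has_bochner_integral_inverse_square_tail:
  assumes a: "a > (0::real)"
  shows "has_bochner_integral lborel (\<lambda>s. indicator {a..} s * (1 / s\<^sup>2)) (1 / a)"
proof (rule has_bochner_integral_nn_integral)
  have "(\<integral>\<^sup>+s. ennreal (1 / s\<^sup>2) * indicator {a..} s \<partial>lborel) = ennreal (0 - (- inverse a))"
  proof (rule nn_integral_FTC_atLeast)
    show "((\<lambda>x::real. - inverse x) \<longlongrightarrow> 0) at_top"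
      using tendsto_minus[OF tendsto_inverse_0_at_top[OF filterlim_ident]] by simp
  qed (use a in \<open>auto intro!: derivative_eq_intros simp: power2_eq_square divide_inverse\<close>)
  moreover have "ennreal (indicator {a..} s * (1 / s\<^sup>2)) = ennreal (1 / s\<^sup>2) * indicator {a..} s" for s
    by (simp split: split_indicator)
  ultimately show "(\<integral>\<^sup>+s. ennreal (indicator {a..} s * (1 / s\<^sup>2)) \<partial>lborel) = ennreal (1 / a)"
    by (simp add: inverse_eq_divide)
qed (use a in auto)

lemma integral_Icc_le_lebesgue_integral:
  fixes f :: "real \<Rightarrow> real"
  assumes f: "integrable lborel f" and nn: "\<And>x. f x \<ge> 0" and c: "continuous_on {a..b} f"
  shows "integral {a..b} f \<le> (LINT x|lborel. f x)"
proof -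
  have "integral {a..b} f = (LINT x:{a..b}|lborel. f x)"
    by (rule set_borel_integral_eq_integral(2)[symmetric, OF borel_integrable_atLeastAtMost'[OF c]])
  also have "\<dots> \<le> (LINT x|lborel. f x)"
    unfolding set_lebesgue_integral_def
    using borel_integrable_atLeastAtMost'[OF c] f nn
    by (intro integral_mono) (auto simp: set_integrable_def split: split_indicator)
  finally show ?thesis .
qed

text \<open>\<open>K\<close> is a strictly positive upper bound, so that Cauchy-Schwarz can be replaced by
  \<open>2 p q \<le> p\<^sup>2 / c + c q\<^sup>2\<close> with weights \<open>c\<close> proportional to \<open>K\<close>.\<close>

locale fourier_profile =
  fixes F G1 :: "real \<Rightarrow> complex" and K :: real
  assumes K: "K > 0"
    and cont_F: "continuous_on UNIV F"
    and deriv_G: "((\<lambda>s. s *\<^sub>R F s) has_vector_derivative G1 s) (at s)"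
    and cont_G1: "continuous_on UNIV G1"
    and F2: "integrable lborel (\<lambda>s. (norm (F s))\<^sup>2)" "(LINT s|lborel. (norm (F s))\<^sup>2) \<le> K\<^sup>2"
    and G2: "integrable lborel (\<lambda>s. (norm (s *\<^sub>R F s))\<^sup>2)" "(LINT s|lborel. (norm (s *\<^sub>R F s))\<^sup>2) \<le> K\<^sup>2"
    and G12: "integrable lborel (\<lambda>s. (norm (G1 s))\<^sup>2)" "(LINT s|lborel. (norm (G1 s))\<^sup>2) \<le> K\<^sup>2"
begin

abbreviation "G \<equiv> \<lambda>s. s *\<^sub>R F s"

text \<open>This reduces negative frequencies to positive ones. In the derivative, the sign from the
  factor \<open>s\<close> and the sign from the chain rule cancel.\<close>

lemma reflect: "fourier_profile (\<lambda>s. F (- s)) (\<lambda>s. G1 (- s)) K"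
proof
  have refl: "integrable lborel (\<lambda>s. f (- s))" "(LINT s|lborel. f (- s)) = (LINT s|lborel. f s)"
    if "integrable lborel f" for f :: "real \<Rightarrow> real"
    using lborel_integrable_real_affine[OF that, of "-1" 0] lborel_integral_real_affine[of "-1" f 0]
    by simp_all
  show "((\<lambda>s. s *\<^sub>R F (- s)) has_vector_derivative G1 (- s)) (at s)" for s
  proof -
    have "(uminus has_vector_derivative - 1) (at s)" by (auto intro!: derivative_eq_intros)
    from has_vector_derivative_minus[OF vector_diff_chain_at[OF this deriv_G]] show ?thesis
      by (simp add: o_def)
  qed
  show "continuous_on UNIV (\<lambda>s. F (- s))" "continuous_on UNIV (\<lambda>s. G1 (- s))"
    by (auto intro!: continuous_on_compose2[OF cont_F] continuous_on_compose2[OF cont_G1] continuous_intros)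
  show "integrable lborel (\<lambda>s. (norm (F (- s)))\<^sup>2)" "(LINT s|lborel. (norm (F (- s)))\<^sup>2) \<le> K\<^sup>2"
    using refl[OF F2(1)] F2(2) by auto
  show "integrable lborel (\<lambda>s. (norm (s *\<^sub>R F (- s)))\<^sup>2)" "(LINT s|lborel. (norm (s *\<^sub>R F (- s)))\<^sup>2) \<le> K\<^sup>2"
    using refl[OF G2(1)] G2(2) by auto
  show "integrable lborel (\<lambda>s. (norm (G1 (- s)))\<^sup>2)" "(LINT s|lborel. (norm (G1 (- s)))\<^sup>2) \<le> K\<^sup>2"
    using refl[OF G12(1)] G12(2) by auto
qed (rule K)

text \<open>Conjugation reverses the sign of the phase and so reduces negative times to positive
  ones.\<close>

lemma conjugate: "fourier_profile (\<lambda>s. cnj (F s)) (\<lambda>s. cnj (G1 s)) K"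
proof
  show "((\<lambda>s. s *\<^sub>R cnj (F s)) has_vector_derivative cnj (G1 s)) (at s)" for s
    using has_vector_derivative_cnj[OF deriv_G] by simp
qed (use K F2 G2 G12 cont_F cont_G1 in \<open>auto intro!: continuous_intros\<close>)

lemma measurable_F [measurable]: "F \<in> borel_measurable borel"
  using cont_F by (rule borel_measurable_continuous_onI)

text \<open>Writing \<open>F\<close> as \<open>sqrt (1 + s\<^sup>2) * F\<close> times
  \<open>1 / sqrt (1 + s\<^sup>2)\<close> and using weighted squares controls its integral by the
  square integrals of \<open>F\<close> and \<open>G\<close>. This yields absolute convergence and
  settles bounded times.\<close>

lemma integrable_F: "integrable lborel F"
  and integral_norm_F: "(LINT s|lborel. norm (F s)) \<le> 3 * K"
proof -
  define B where "B s = (((norm (F s))\<^sup>2 + (norm (G s))\<^sup>2) / K + K * (1 / (1 + s\<^sup>2))) / 2" for s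
  have le: "norm (F s) \<le> B s" for s
  proof -
    have pos: "1 + s\<^sup>2 > 0" by (simp add: add_pos_nonneg)
    have "norm (F s) = (sqrt (1 + s\<^sup>2) * norm (F s)) * (1 / sqrt (1 + s\<^sup>2))"
      using pos by simp
    also have "\<dots> \<le> ((sqrt (1 + s\<^sup>2) * norm (F s))\<^sup>2 / K + K * (1 / sqrt (1 + s\<^sup>2))\<^sup>2) / 2"
      by (rule two_mult_le_weighted_squares[OF K])
    also have "\<dots> = B s" using pos by (simp add: B_def power_mult_distrib power_divide algebra_simps)
    finally show ?thesis .
  qed
  have hB: "has_bochner_integral lborel B
      ((((LINT s|lborel. (norm (F s))\<^sup>2) + (LINT s|lborel. (norm (G s))\<^sup>2)) / K + K * pi) / 2)"
    unfolding B_def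
    by (intro has_bochner_integral_divide has_bochner_integral_add has_bochner_integral_mult_right
        has_bochner_integral_integrable F2 G2 has_bochner_integral_inverse_one_plus_square)
  then have iB: "integrable lborel B" by (rule integrable.intros)
  show i: "integrable lborel F"
    by (rule Bochner_Integration.integrable_bound[OF iB]) (use order_trans[OF le abs_ge_self] in auto)
  have "(LINT s|lborel. norm (F s)) \<le> (LINT s|lborel. B s)"
    using i iB le by (intro integral_mono) auto
  also have "\<dots> = (((LINT s|lborel. (norm (F s))\<^sup>2) + (LINT s|lborel. (norm (G s))\<^sup>2)) / K + K * pi) / 2"
    by (rule has_bochner_integral_integral_eq[OF hB])
  also have "\<dots> \<le> ((K\<^sup>2 + K\<^sup>2) / K + K * pi) / 2"
    using K F2 G2 by (intro divide_right_mono add_right_mono add_mono) auto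
  also have "\<dots> = K * ((2 + pi) / 2)" using K by (simp add: power2_eq_square field_simps)
  also have "\<dots> \<le> K * 3" using K pi_less_4 by (intro mult_left_mono) auto
  finally show "(LINT s|lborel. norm (F s)) \<le> 3 * K" by simp
qed

text \<open>For \<open>s \<le> 1\<close>, \<open>G 0 = 0\<close> and a Cauchy-Schwarz estimate of
  the integral of \<open>G1\<close> give \<open>K * sqrt s\<close>, and
  \<open>sqrt s \<le> s powr (1 / \<beta>)\<close>. For \<open>s > 1\<close>, integrating the
  derivative of \<open>(norm (G s))\<^sup>2\<close> gives the uniform bound \<open>2 * K\<close>.
  The power is chosen to make \<open>G (u powr \<beta>) / u\<close> bounded.\<close>

lemma norm_G_bound:
  assumes s: "s > 0" and \<beta>: "\<beta> \<ge> 2"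
  shows "norm (G s) \<le> 2 * K * s powr (1 / \<beta>)"
proof (cases "s \<le> 1")
  case True
  have cG1: "continuous_on {0..s} G1" using cont_G1 by (rule continuous_on_subset) simp
  have "(G1 has_integral (G s - G 0)) {0..s}"
    using s by (intro fundamental_theorem_of_calculus) (auto intro: has_vector_derivative_at_within deriv_G)
  then have eq: "G s = integral {0..s} G1" and iG1: "G1 integrable_on {0..s}"
    by (simp_all add: integral_unique has_integral_integrable)
  \<comment> \<open>This weight equalizes the two terms: \<open>K\<^sup>2 / c\<close> and
    \<open>s * c\<close> are both \<open>K * sqrt s\<close>.\<close>
  define c where "c = K / sqrt s"
  have c: "c > 0" using K s by (simp add: c_def)
  have i1: "(\<lambda>r. (norm (G1 r))\<^sup>2) integrable_on {0..s}"
    by (intro integrable_continuous_real continuous_intros cG1)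
  have hi: "((\<lambda>r. ((norm (G1 r))\<^sup>2 / c + c * 1) / 2) has_integral
      ((integral {0..s} (\<lambda>r. (norm (G1 r))\<^sup>2) / c + (s - 0) *\<^sub>R (c * 1)) / 2)) {0..s}"
    using s by (intro has_integral_divide has_integral_add integrable_integral i1 has_integral_const_real[of _ 0 s, simplified])
       (use has_integral_const_real[of "c * 1" 0 s] in simp)
  have "norm (G s) \<le> integral {0..s} (\<lambda>r. ((norm (G1 r))\<^sup>2 / c + c * 1) / 2)"
    unfolding eq
  proof (rule integral_norm_bound_integral[OF iG1 has_integral_integrable[OF hi]])
    show "norm (G1 r) \<le> ((norm (G1 r))\<^sup>2 / c + c * 1) / 2" for r
      using two_mult_le_weighted_squares[OF c, of "norm (G1 r)" 1] by simp
  qed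
  also have "\<dots> = (integral {0..s} (\<lambda>r. (norm (G1 r))\<^sup>2) / c + s * c) / 2"
    using integral_unique[OF hi] by simp
  also have "\<dots> \<le> (K\<^sup>2 / c + s * c) / 2"
  proof (intro divide_right_mono add_right_mono)
    show "integral {0..s} (\<lambda>r. (norm (G1 r))\<^sup>2) \<le> K\<^sup>2"
      by (rule order_trans[OF integral_Icc_le_lebesgue_integral[OF G12(1)] G12(2)]) (auto intro!: continuous_intros cG1)
  qed (use c in auto)
  also have "\<dots> = K * sqrt s"
    using s K real_sqrt_mult_self[of s] by (simp add: c_def power2_eq_square field_simps)
  also have "\<dots> = K * s powr (1 / 2)" using s by (simp add: powr_half_sqrt)
  also have "\<dots> \<le> K * s powr (1 / \<beta>)"
    using s True \<beta> K by (intro mult_left_mono powr_mono') (auto simp: field_simps)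
  also have "\<dots> \<le> 2 * K * s powr (1 / \<beta>)" using K by simp
  finally show ?thesis .
next
  case False
  have cG1: "continuous_on {0..s} G1" and cF: "continuous_on {0..s} F"
    using cont_G1 cont_F by (auto intro: continuous_on_subset)
  define h where "h r = 2 * (G r \<bullet> G1 r)" for r
  have "(h has_integral ((norm (G s))\<^sup>2 - (norm (G 0))\<^sup>2)) {0..s}"
  proof (rule fundamental_theorem_of_calculus)
    fix r
    have "((\<lambda>r. G r \<bullet> G r) has_derivative (\<lambda>k. G r \<bullet> (k *\<^sub>R G1 r) + (k *\<^sub>R G1 r) \<bullet> G r)) (at r)"
      using deriv_G[of r] unfolding has_vector_derivative_def by (intro has_derivative_inner)
    then have "((\<lambda>r. G r \<bullet> G r) has_vector_derivative h r) (at r)"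
      unfolding has_vector_derivative_def h_def by (rule has_derivative_eq_rhs) (auto simp: inner_commute algebra_simps)
    then show "((\<lambda>r. (norm (G r))\<^sup>2) has_vector_derivative h r) (at r within {0..s})"
      unfolding power2_norm_eq_inner by (rule has_vector_derivative_at_within)
  qed (use s in simp)
  then have eq: "(norm (G s))\<^sup>2 = integral {0..s} h" and ih: "h integrable_on {0..s}"
    by (simp_all add: integral_unique has_integral_integrable)
  have ii: "(\<lambda>r. (norm (G r))\<^sup>2) integrable_on {0..s}" "(\<lambda>r. (norm (G1 r))\<^sup>2) integrable_on {0..s}"
    by (intro integrable_continuous_real continuous_intros cG1 cF)+
  have "(norm (G s))\<^sup>2 \<le> integral {0..s} (\<lambda>r. (norm (G r))\<^sup>2 + (norm (G1 r))\<^sup>2)"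
    unfolding eq
  proof (rule integral_le[OF ih integrable_add[OF ii]])
    fix r
    have "h r \<le> 2 * (norm (G r) * norm (G1 r))" using norm_cauchy_schwarz[of "G r" "G1 r"] by (simp add: h_def)
    also have "\<dots> \<le> (norm (G r))\<^sup>2 + (norm (G1 r))\<^sup>2" using sum_squares_bound[of "norm (G r)" "norm (G1 r)"] by simp
    finally show "h r \<le> (norm (G r))\<^sup>2 + (norm (G1 r))\<^sup>2" .
  qed
  also have "\<dots> = integral {0..s} (\<lambda>r. (norm (G r))\<^sup>2) + integral {0..s} (\<lambda>r. (norm (G1 r))\<^sup>2)"
    by (rule integral_add[OF ii])
  also have "\<dots> \<le> K\<^sup>2 + K\<^sup>2"
  proof (rule add_mono)
    show "integral {0..s} (\<lambda>r. (norm (G r))\<^sup>2) \<le> K\<^sup>2"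
      by (rule order_trans[OF integral_Icc_le_lebesgue_integral[OF G2(1)] G2(2)]) (auto intro!: continuous_intros cF)
    show "integral {0..s} (\<lambda>r. (norm (G1 r))\<^sup>2) \<le> K\<^sup>2"
      by (rule order_trans[OF integral_Icc_le_lebesgue_integral[OF G12(1)] G12(2)]) (auto intro!: continuous_intros cG1)
  qed
  also have "\<dots> \<le> (2 * K)\<^sup>2" by (simp add: power2_eq_square)
  finally have "norm (G s) \<le> 2 * K" using K power2_le_imp_le[of "norm (G s)" "2 * K"] by simp
  also have "\<dots> \<le> 2 * K * s powr (1 / \<beta>)"
    using K False \<beta> ge_one_powr_ge_zero[of s "1 / \<beta>"] by simp
  finally show ?thesis .
qed

section \<open>Frequency pieces and their assembly\<close>

text \<open>The substitution \<open>s = u powr \<beta>\<close> with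
  \<open>\<beta> = 2 / \<alpha>\<close> makes the time phase quadratic, while the Jacobian and
  \<open>F s = G s / s\<close> combine to the amplitude
  \<open>\<beta> * G (u powr \<beta>) / u\<close>. The range of \<open>\<alpha>\<close> is exactly
  \<open>3 \<le> \<beta> \<le> 6\<close>.\<close>

lemma middle_frequency_bound:
  assumes t: "t \<ge> 1" and al: "1 / 3 \<le> \<alpha>" "\<alpha> \<le> 2 / 3"
  shows "norm (integral {1 / t..t} (\<lambda>s. cis (x * s + t * s powr \<alpha>) * F s)) \<le> 1200 * K / sqrt t"
proof -
  define \<beta> where "\<beta> = 2 / \<alpha>"
  have b: "3 \<le> \<beta>" "\<beta> \<le> 6" "\<alpha> = 2 / \<beta>" using al by (auto simp: \<beta>_def field_simps)
  define l r where "l = (1 / t) powr (1 / \<beta>)" and "r = t powr (1 / \<beta>)"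
  have "1 / t \<le> t" 
    using t by (intro order_trans[of "1 / t" 1 t]) (auto simp: field_simps)
  then have lr: "0 < l" "l \<le> r" using t b by (auto simp: l_def r_def intro!: powr_mono2)
  have lb: "l powr \<beta> = 1 / t" and rb: "r powr \<beta> = t"
    using t b by (simp_all add: l_def r_def powr_powr)
  define f where "f s = cis (x * s + t * s powr \<alpha>) * F s" for s
  have "norm (integral {l..r} (\<lambda>u. cis (t * u\<^sup>2 + x * u powr \<beta>) * ((1 / u) *\<^sub>R G (u powr \<beta>))))
      \<le> (2 * K * (1 + 24 * pi) + K * (1 + 6 * pi)) / sqrt t"
  proof (rule oscillatory_core[OF t b(1,2) lr])
    show "continuous_on {0<..} G1" using cont_G1 by (rule continuous_on_subset) simp
    show "norm (G (u powr \<beta>)) \<le> 2 * K * u" if "u \<in> {l..r}" for u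
      using norm_G_bound[of "u powr \<beta>" \<beta>] that lr b by (simp add: powr_powr)
    show "integral {l powr \<beta>..r powr \<beta>} (\<lambda>s. (norm (G1 s))\<^sup>2) \<le> K\<^sup>2"
      by (rule order_trans[OF integral_Icc_le_lebesgue_integral[OF G12(1)] G12(2)])
         (auto intro!: continuous_intros continuous_on_subset[OF cont_G1])
  qed (use rb deriv_G K in auto)
  moreover have "((\<lambda>u. (\<beta> * u powr (\<beta> - 1)) *\<^sub>R f (u powr \<beta>)) has_integral (integral {l powr \<beta>..r powr \<beta>} f)) {l..r}"
  proof (rule has_integral_substitution[where c = "l powr \<beta>" and d = "r powr \<beta>"])
    show "continuous_on {l powr \<beta>..r powr \<beta>} f"
      unfolding f_def lb rb using t al
      by (intro continuous_intros continuous_on_subset[OF cont_F] continuous_on_powr') auto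
    show "((\<lambda>u. u powr \<beta>) has_real_derivative \<beta> * u powr (\<beta> - 1)) (at u within {l..r})" if "u \<in> {l..r}" for u
      using that lr by (auto intro!: derivative_eq_intros)
    show "(\<lambda>u. u powr \<beta>) ` {l..r} \<subseteq> {l powr \<beta>..r powr \<beta>}" "l powr \<beta> \<le> r powr \<beta>"
      using lr b by (auto intro!: powr_mono2)
  qed (rule lr)
  then have "((\<lambda>u. \<beta> *\<^sub>R (cis (t * u\<^sup>2 + x * u powr \<beta>) * ((1 / u) *\<^sub>R G (u powr \<beta>)))) has_integral integral {1 / t..t} f) {l..r}"
    unfolding lb rb
  proof (rule has_integral_eq[rotated])
    fix u assume "u \<in> {l..r}"
    then have u: "u > 0" using lr by simp
    have "(u powr \<beta>) powr \<alpha> = u\<^sup>2" using u b by (simp add: powr_powr)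
    moreover have "u powr \<beta> = u * u powr (\<beta> - 1)" using u powr_add[of u 1 "\<beta> - 1"] by simp
    ultimately show "(\<beta> * u powr (\<beta> - 1)) *\<^sub>R f (u powr \<beta>)
      = \<beta> *\<^sub>R (cis (t * u\<^sup>2 + x * u powr \<beta>) * ((1 / u) *\<^sub>R G (u powr \<beta>)))"
      using u by (simp add: f_def add.commute scaleR_conv_of_real)
  qed
  from integral_unique[OF this] have "integral {1 / t..t} f = \<beta> *\<^sub>R integral {l..r} (\<lambda>u. cis (t * u\<^sup>2 + x * u powr \<beta>) * ((1 / u) *\<^sub>R G (u powr \<beta>)))"
    by (simp only: integral_cmul)
  then have "norm (integral {1 / t..t} f)
      = \<beta> * norm (integral {l..r} (\<lambda>u. cis (t * u\<^sup>2 + x * u powr \<beta>) * ((1 / u) *\<^sub>R G (u powr \<beta>))))"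
    using b by (simp only: norm_scaleR)
  ultimately have "norm (integral {1 / t..t} f) \<le> 6 * ((2 * K * (1 + 24 * pi) + K * (1 + 6 * pi)) / sqrt t)"
    using b by (simp only:) (intro mult_mono; simp)
  \<comment> \<open>The amplitude bound \<open>M = 2 * K\<close> and \<open>\<beta> \<le> 6\<close>
    give \<open>6 * (3 + 54 * pi) * K\<close>; 1200 is a rounding.\<close>
  also have "\<dots> = (18 + 324 * pi) * K / sqrt t" by (simp add: field_simps)
  also have "\<dots> \<le> 1200 * K / sqrt t"
    using K t pi_approx by (intro divide_right_mono mult_right_mono) auto
  finally show ?thesis by (simp add: f_def[abs_def])
qed

lemma integrable_phase: "integrable lborel (\<lambda>s. cis (x * s + t * \<bar>s\<bar> powr \<alpha>) * F s)"
  by (rule Bochner_Integration.integrable_bound[OF integrable_F]) (auto simp: norm_mult cis_conv_exp)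

text \<open>Frequencies below \<open>1 / t\<close> occupy an interval of length
  \<open>1 / t\<close>. Above \<open>t\<close> one has \<open>F s = G s / s\<close>, and
  \<open>1 / s\<^sup>2\<close> integrates to \<open>1 / t\<close> there. By weighted squares each
  piece costs \<open>K / sqrt t\<close>.\<close>

lemma half_line_bound:
  assumes t: "t \<ge> 1" and al: "1 / 3 \<le> \<alpha>" "\<alpha> \<le> 2 / 3"
  shows "norm (LINT s:{0..}|lborel. cis (x * s + t * \<bar>s\<bar> powr \<alpha>) * F s) \<le> 1202 * K / sqrt t"
proof -
  define f where "f s = cis (x * s + t * \<bar>s\<bar> powr \<alpha>) * F s" for s
  have f: "integrable lborel f" unfolding f_def[abs_def] by (rule integrable_phase)
  have nf: "norm (f s) = norm (F s)" for s by (simp add: f_def norm_mult)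
  \<comment> \<open>\<open>R\<close> is \<open>f\<close> restricted to the two outer pieces, below
    \<open>1 / t\<close> and above \<open>t\<close>.\<close>
  define R where "R s = (indicator {0..} s - indicator {1 / t..t} s :: real) *\<^sub>R f s" for s
  \<comment> \<open>This choice makes \<open>K\<^sup>2 / c\<close> and \<open>c / t\<close> both
    equal to \<open>K / sqrt t\<close>.\<close>
  define c where "c = K * sqrt t"
  have c: "c > 0" using K t by (simp add: c_def)
  have iA: "integrable lborel (\<lambda>s. indicator A s *\<^sub>R f s)" if "A \<in> sets borel" for A
    using f that by (simp add: integrable_mult_indicator)
  have iR: "integrable lborel R"
    unfolding R_def scaleR_diff_left by (intro Bochner_Integration.integrable_diff iA) auto
  have eq: "(LINT s:{0..}|lborel. f s) = (LINT s:{1 / t..t}|lborel. f s) + (LINT s|lborel. R s)"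
    unfolding set_lebesgue_integral_def R_def scaleR_diff_left
    by (subst Bochner_Integration.integral_diff) (auto intro!: iA)
  have "(LINT s:{1 / t..t}|lborel. f s) = integral {1 / t..t} f"
    by (rule set_borel_integral_eq_integral(2)) (use iA in \<open>simp add: set_integrable_def\<close>)
  also have "\<dots> = integral {1 / t..t} (\<lambda>s. cis (x * s + t * s powr \<alpha>) * F s)"
    using t by (intro integral_cong) (auto simp: f_def order_trans[of 0 "1 / t"])
  finally have mid: "norm (LINT s:{1 / t..t}|lborel. f s) \<le> 1200 * K / sqrt t"
    using middle_frequency_bound[OF t al] by simp
  define B where "B s = ((norm (F s))\<^sup>2 / c + c * indicator {0..1 / t} s) / 2
      + ((norm (G s))\<^sup>2 / c + c * (indicator {t..} s * (1 / s\<^sup>2))) / 2" for s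
  have RB: "norm (R s) \<le> B s" for s
  proof -
    have nn: "0 \<le> ((norm (F s))\<^sup>2 / c + c * indicator {0..1 / t} s) / 2"
      "0 \<le> ((norm (G s))\<^sup>2 / c + c * (indicator {t..} s * (1 / s\<^sup>2))) / 2"
      using c by auto
    consider "0 \<le> s" "s < 1 / t" | "t < s" | "s < 0 \<or> s \<in> {1 / t..t}" by fastforce
    then show ?thesis
    proof cases
      case 1
      have "s < t" using 1 t by (smt (verit) divide_le_eq_1_pos)
      then have "norm (R s) = norm (F s) * 1" using 1 by (simp add: R_def nf)
      also have "\<dots> \<le> ((norm (F s))\<^sup>2 / c + c * 1\<^sup>2) / 2" by (rule two_mult_le_weighted_squares[OF c])
      finally have "norm (R s) \<le> ((norm (F s))\<^sup>2 / c + c * indicator {0..1 / t} s) / 2" using 1 by simp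
      then show ?thesis using nn unfolding B_def by linarith
    next
      case 2
      then have s: "s > 0" using t by simp
      then have "norm (R s) = norm (G s) * (1 / s)" using 2 by (simp add: R_def nf)
      also have "\<dots> \<le> ((norm (G s))\<^sup>2 / c + c * (1 / s)\<^sup>2) / 2" by (rule two_mult_le_weighted_squares[OF c])
      finally have "norm (R s) \<le> ((norm (G s))\<^sup>2 / c + c * (indicator {t..} s * (1 / s\<^sup>2))) / 2"
        using 2 by (simp add: power_divide)
      then show ?thesis using nn unfolding B_def by linarith
    next
      case 3
      moreover have "0 \<le> s" if "1 / t \<le> s" using t by (intro order_trans[OF _ that]) simp
      ultimately have "R s = 0" by (auto simp: R_def split: split_indicator)
      then show ?thesis using nn by (simp add: B_def)
    qed
  qed
  have hI: "has_bochner_integral lborel (indicator {0..1 / t} :: real \<Rightarrow> real) (1 / t)"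
    using has_bochner_integral_real_indicator[of "{0..1 / t}" lborel] t by simp
  have hB: "has_bochner_integral lborel B (((LINT s|lborel. (norm (F s))\<^sup>2) / c + c * (1 / t)) / 2
      + ((LINT s|lborel. (norm (G s))\<^sup>2) / c + c * (1 / t)) / 2)"
    unfolding B_def using t
    by (intro has_bochner_integral_divide has_bochner_integral_add has_bochner_integral_mult_right
        has_bochner_integral_integrable F2 G2 hI has_bochner_integral_inverse_square_tail) auto
  have "norm (LINT s|lborel. R s) \<le> (LINT s|lborel. B s)"
    by (rule Bochner_Integration.integral_norm_bound_integral[OF iR has_bochner_integral_iff[THEN iffD1, OF hB, THEN conjunct1] RB])
  also have "\<dots> = ((LINT s|lborel. (norm (F s))\<^sup>2) / c + c * (1 / t)) / 2
      + ((LINT s|lborel. (norm (G s))\<^sup>2) / c + c * (1 / t)) / 2"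
    by (rule has_bochner_integral_integral_eq[OF hB])
  also have "\<dots> \<le> (K\<^sup>2 / c + c * (1 / t)) / 2 + (K\<^sup>2 / c + c * (1 / t)) / 2"
    using c F2 G2 by (intro add_mono divide_right_mono order_refl) auto
  also have "\<dots> = K\<^sup>2 / c + c / t" by simp
  also have "\<dots> = 2 * K / sqrt t"
    using K t real_sqrt_mult_self[of t] by (simp add: c_def power2_eq_square field_simps)
  finally have rest: "norm (LINT s|lborel. R s) \<le> 2 * K / sqrt t" .
  have "norm (LINT s:{0..}|lborel. f s) \<le> 1200 * K / sqrt t + 2 * K / sqrt t"
    unfolding eq by (rule order_trans[OF norm_triangle_ineq add_mono[OF mid rest]])
  also have "\<dots> = 1202 * K / sqrt t" by (simp add: field_simps)
  finally show ?thesis by (simp add: f_def)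
qed

text \<open>Since \<open>\<bar>s\<bar> powr \<alpha>\<close> is even, the negative half-line
  contributes a positive half-line integral of the reflected profile with \<open>x\<close> replaced
  by \<open>- x\<close>.\<close>

lemma line_bound_ge_one:
  assumes t: "t \<ge> 1" and al: "1 / 3 \<le> \<alpha>" "\<alpha> \<le> 2 / 3"
  shows "norm (LINT s|lborel. cis (x * s + t * \<bar>s\<bar> powr \<alpha>) * F s) \<le> 2404 * K / sqrt t"
proof -
  interpret rf: fourier_profile "\<lambda>s. F (- s)" "\<lambda>s. G1 (- s)" K by (rule reflect)
  define f where "f s = cis (x * s + t * \<bar>s\<bar> powr \<alpha>) * F s" for s
  have f: "integrable lborel f" unfolding f_def[abs_def] by (rule integrable_phase)
  have iA: "integrable lborel (\<lambda>s. indicator A s *\<^sub>R f s)" if "A \<in> sets borel" for A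
    using f that by (simp add: integrable_mult_indicator)
  have "(LINT s|lborel. f s) = (LINT s|lborel. indicator {0..} s *\<^sub>R f s + indicator {..<0} s *\<^sub>R f s)"
    by (intro Bochner_Integration.integral_cong) (auto split: split_indicator)
  also have "\<dots> = (LINT s:{0..}|lborel. f s) + (LINT s|lborel. indicator {..<0} s *\<^sub>R f s)"
    unfolding set_lebesgue_integral_def by (intro Bochner_Integration.integral_add iA) auto
  also have "(LINT s|lborel. indicator {..<0} s *\<^sub>R f s) = (LINT s|lborel. indicator {..<0} (- s) *\<^sub>R f (- s))"
    using lborel_integral_real_affine[of "-1" "\<lambda>s. indicator {..<0} s *\<^sub>R f s" 0] by simp
  also have "\<dots> = (LINT s:{0..}|lborel. f (- s))"
    unfolding set_lebesgue_integral_def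
  proof (rule integral_cong_AE)
    have [measurable]: "f \<in> borel_measurable borel" using borel_measurable_integrable[OF f] by simp
    show "(\<lambda>s. indicator {..<0} (- s) *\<^sub>R f (- s)) \<in> borel_measurable lborel"
      "(\<lambda>s. indicator {0..} s *\<^sub>R f (- s)) \<in> borel_measurable lborel" by measurable
    \<comment> \<open>The two indicators differ only at \<open>s = 0\<close>, a null set.\<close>
    show "AE s in lborel. indicator {..<0} (- s) *\<^sub>R f (- s) = indicator {0..} s *\<^sub>R f (- s)"
      using AE_lborel_singleton[of "0::real"] by eventually_elim (auto split: split_indicator)
  qed
  finally have "norm (LINT s|lborel. f s) \<le> norm (LINT s:{0..}|lborel. f s) + norm (LINT s:{0..}|lborel. f (- s))"
    by (simp add: norm_triangle_ineq)
  moreover have "norm (LINT s:{0..}|lborel. f s) \<le> 1202 * K / sqrt t"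
    unfolding f_def by (rule half_line_bound[OF t al])
  moreover have "norm (LINT s:{0..}|lborel. f (- s)) \<le> 1202 * K / sqrt t"
    using rf.half_line_bound[OF t al, of "- x"] by (simp add: f_def)
  moreover have "1202 * K / sqrt t + 1202 * K / sqrt t = 2404 * K / sqrt t" by simp
  ultimately have "norm (LINT s|lborel. f s) \<le> 2404 * K / sqrt t" by linarith
  then show ?thesis by (simp add: f_def)
qed

text \<open>For \<open>\<bar>t\<bar> < 1\<close> the integral of \<open>norm (F s)\<close> is a
  sufficient bound; for \<open>t \<le> - 1\<close> conjugation leads to time
  \<open>\<bar>t\<bar>\<close>.\<close>

lemma dispersive_bound:
  assumes al: "1 / 3 \<le> \<alpha>" "\<alpha> \<le> 2 / 3"
  shows "norm (LINT s|lborel. cis (x * s + t * \<bar>s\<bar> powr \<alpha>) * F s) \<le> 5000 * K * (1 + \<bar>t\<bar>) powr (- 1 / 2)"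
proof -
  define q where "q = (1 + \<bar>t\<bar>) powr (- 1 / 2)"
  have q: "q = 1 / sqrt (1 + \<bar>t\<bar>)"
    using powr_minus_divide[of "1 + \<bar>t\<bar>" "1 / 2"] by (simp add: q_def powr_half_sqrt)
  \<comment> \<open>The factor \<open>2 * q\<close> covers both regimes, because
    \<open>1 + \<bar>t\<bar>\<close> is at most 4 for small times and at most
    \<open>4 * \<bar>t\<bar>\<close> otherwise. It doubles 2500 to the final 5000.\<close>
  have "norm (LINT s|lborel. cis (x * s + t * \<bar>s\<bar> powr \<alpha>) * F s) \<le> 2500 * K * (2 * q)"
  proof (cases "\<bar>t\<bar> < 1")
    case True
    have "sqrt (1 + \<bar>t\<bar>) \<le> sqrt 4" using True by (intro real_sqrt_le_mono) simp
    then have "1 \<le> 2 * q" by (simp add: q field_simps add_pos_nonneg)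
    have "norm (LINT s|lborel. cis (x * s + t * \<bar>s\<bar> powr \<alpha>) * F s) \<le> (LINT s|lborel. norm (F s))"
      using integral_norm_bound[of lborel "\<lambda>s. cis (x * s + t * \<bar>s\<bar> powr \<alpha>) * F s"] by (simp add: norm_mult)
    also have "\<dots> \<le> 2500 * K" using integral_norm_F K by simp
    also have "\<dots> \<le> 2500 * K * (2 * q)" using \<open>1 \<le> 2 * q\<close> K by simp
    finally show ?thesis .
  next
    case False
    have "norm (LINT s|lborel. cis (x * s + t * \<bar>s\<bar> powr \<alpha>) * F s) \<le> 2404 * K / sqrt \<bar>t\<bar>"
    proof (cases "t \<ge> 1")
      case True
      then show ?thesis using line_bound_ge_one[OF True al] by simp
    next
      case neg: False
      interpret cn: fourier_profile "\<lambda>s. cnj (F s)" "\<lambda>s. cnj (G1 s)" K by (rule conjugate)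
      have "cnj (LINT s|lborel. cis (x * s + t * \<bar>s\<bar> powr \<alpha>) * F s)
          = (LINT s|lborel. cis ((- x) * s + \<bar>t\<bar> * \<bar>s\<bar> powr \<alpha>) * cnj (F s))"
        unfolding Bochner_Integration.integral_cnj[symmetric] using neg False by (simp add: cis_cnj)
      then show ?thesis
        using cn.line_bound_ge_one[OF _ al, of "\<bar>t\<bar>" "- x"] False by (metis complex_mod_cnj not_less)
    qed
    also have "\<dots> \<le> 2500 * K / sqrt \<bar>t\<bar>" using K by (intro divide_right_mono) auto
    also have "\<dots> \<le> 2500 * K * (2 * q)"
    proof -
      have "sqrt (1 + \<bar>t\<bar>) \<le> sqrt (4 * \<bar>t\<bar>)" using False by (intro real_sqrt_le_mono) simp
      then have "1 / sqrt \<bar>t\<bar> \<le> 2 * q" using False by (simp add: q real_sqrt_mult field_simps add_pos_nonneg)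
      then have "2500 * K * (1 / sqrt \<bar>t\<bar>) \<le> 2500 * K * (2 * q)" using K by (intro mult_left_mono) auto
      then show ?thesis by simp
    qed
    finally show ?thesis .
  qed
  then show ?thesis by (simp add: q_def)
qed

end

section \<open>The Fourier transform\<close>

lemma measurable_cis [measurable]: "cis \<in> borel_measurable borel"
  by (intro borel_measurable_continuous_onI continuous_intros)

lemma integrable_cis_mult [simp]:
  assumes "integrable lborel f" and [measurable]: "p \<in> borel_measurable borel"
  shows "integrable lborel (\<lambda>x. cis (p x) * f x)"
proof -
  have [measurable]: "f \<in> borel_measurable borel" using borel_measurable_integrable[OF assms(1)] by simp
  show ?thesis
    by (rule Bochner_Integration.integrable_bound[OF assms(1)]) (auto simp: norm_mult)
qed

lemma measurable_fourier [measurable]: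
  assumes [measurable]: "f \<in> borel_measurable borel"
  shows "fourier f \<in> borel_measurable borel"
  unfolding fourier_def by measurable

lemma norm_fourier_le: "norm (fourier f \<xi>) \<le> (LINT x|lborel. norm (f x))"
  unfolding fourier_def using integral_norm_bound[of lborel "\<lambda>x. cis (- (x * \<xi>)) * f x"]
  by (simp add: norm_mult)

lemma norm_cis_minus_linear_le: "norm (cis y - 1 - \<i> * of_real y) \<le> y\<^sup>2 / 2"
  using iexp_approx1[of y 1] by (simp add: cis_conv_exp numeral_2_eq_2 diff_diff_eq)

text \<open>The second moment of \<open>f\<close> controls the integrated first-order Taylor
  remainder of \<open>cis\<close> by \<open>C * h\<^sup>2\<close>, so the difference quotient
  converges with an explicit rate.\<close>

lemma fourier_has_vector_derivative:
  assumes f0: "integrable lborel f" and f1: "integrable lborel (\<lambda>x. x *\<^sub>R f x)"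
    and f2: "integrable lborel (\<lambda>x. x\<^sup>2 *\<^sub>R f x)"
  shows "(fourier f has_vector_derivative - \<i> * fourier (\<lambda>x. x *\<^sub>R f x) \<xi>) (at \<xi>)"
proof -
  define C where "C = (LINT x|lborel. norm (x\<^sup>2 *\<^sub>R f x)) / 2"
  define D where "D = - \<i> * fourier (\<lambda>x. x *\<^sub>R f x) \<xi>"
  have rem: "norm (fourier f (\<xi> + h) - fourier f \<xi> - h *\<^sub>R D) \<le> C * h\<^sup>2" for h
  proof -
    \<comment> \<open>This is the integrand of the remainder with the unimodular factor
      \<open>cis (- (x * \<xi>))\<close> pulled out.\<close>
    define r where "r x = cis (- (x * \<xi>)) * ((cis (- (x * h)) - 1 - \<i> * of_real (- (x * h))) * f x)" for x
    have "(LINT x|lborel. r x) = (LINT x|lborel. (cis (- (x * (\<xi> + h))) * f x - cis (- (x * \<xi>)) * f x)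
        + (\<i> * of_real h) * (cis (- (x * \<xi>)) * (x *\<^sub>R f x)))"
    proof (intro Bochner_Integration.integral_cong refl)
      fix x
      have "cis (- (x * (\<xi> + h))) = cis (- (x * \<xi>)) * cis (- (x * h))" by (simp add: cis_mult algebra_simps)
      then show "r x = (cis (- (x * (\<xi> + h))) * f x - cis (- (x * \<xi>)) * f x)
          + (\<i> * of_real h) * (cis (- (x * \<xi>)) * (x *\<^sub>R f x))"
        by (simp add: r_def algebra_simps scaleR_conv_of_real)
    qed
    also have "\<dots> = (LINT x|lborel. cis (- (x * (\<xi> + h))) * f x) - (LINT x|lborel. cis (- (x * \<xi>)) * f x)
        + (\<i> * of_real h) * (LINT x|lborel. cis (- (x * \<xi>)) * (x *\<^sub>R f x))"
      by (intro has_bochner_integral_integral_eq has_bochner_integral_add has_bochner_integral_diff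
          has_bochner_integral_mult_right has_bochner_integral_integrable integrable_cis_mult f0 f1) auto
    also have "\<dots> = fourier f (\<xi> + h) - fourier f \<xi> - h *\<^sub>R D"
      by (simp add: fourier_def D_def scaleR_conv_of_real)
    finally have "fourier f (\<xi> + h) - fourier f \<xi> - h *\<^sub>R D = (LINT x|lborel. r x)" ..
    also have "norm \<dots> \<le> (LINT x|lborel. norm (r x))" by (rule integral_norm_bound)
    also have "\<dots> \<le> (LINT x|lborel. (h\<^sup>2 / 2) * norm (x\<^sup>2 *\<^sub>R f x))"
    proof (rule Bochner_Integration.integral_mono')
      show "integrable lborel (\<lambda>x. (h\<^sup>2 / 2) * norm (x\<^sup>2 *\<^sub>R f x))"
        using f2 by (intro integrable_mult_right integrable_norm)
      fix x
      have "norm (r x) \<le> (- (x * h))\<^sup>2 / 2 * norm (f x)"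
        unfolding r_def norm_mult norm_cis mult_1 by (intro mult_right_mono norm_cis_minus_linear_le) simp
      then show "norm (r x) \<le> (h\<^sup>2 / 2) * norm (x\<^sup>2 *\<^sub>R f x)" by (simp add: power_mult_distrib mult_ac)
    qed simp
    also have "\<dots> = C * h\<^sup>2" by (simp add: C_def)
    finally show ?thesis .
  qed
  have "((\<lambda>h. norm (fourier f (\<xi> + h) - fourier f \<xi> - h *\<^sub>R D) / norm h) \<longlongrightarrow> 0) (at 0)"
  proof (rule tendsto_sandwich[OF _ _ tendsto_const])
    show "((\<lambda>h. C * \<bar>h\<bar>) \<longlongrightarrow> 0) (at (0::real))" by (auto intro!: tendsto_eq_intros)
    show "\<forall>\<^sub>F h in at 0. norm (fourier f (\<xi> + h) - fourier f \<xi> - h *\<^sub>R D) / norm h \<le> C * \<bar>h\<bar>"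
      unfolding eventually_at_filter using rem
      by (intro always_eventually) (auto simp: divide_le_eq power2_eq_square abs_mult_self_eq mult.assoc)
  qed auto
  then show ?thesis
    unfolding has_vector_derivative_def has_derivative_at D_def[symmetric]
    by (simp add: bounded_linear_scaleR_left)
qed

text \<open>The fundamental theorem of calculus on the whole line is applied to
  \<open>cis (- (x * \<xi>)) * f x\<close>, whose limits at both ends vanish with those of
  \<open>f\<close>.\<close>

lemma fourier_deriv:
  assumes d: "\<And>x. (f has_vector_derivative f' x) (at x)" and c: "continuous_on UNIV f'"
    and f: "integrable lborel f" and f': "integrable lborel f'"
    and lim: "(f \<longlongrightarrow> 0) at_top" "(f \<longlongrightarrow> 0) at_bot"
  shows "fourier f' \<xi> = \<i> * of_real \<xi> * fourier f \<xi>"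
proof -
  define W where "W x = cis (- (x * \<xi>)) * f x" for x
  define w where "w x = cis (- (x * \<xi>)) * f' x - (\<i> * of_real \<xi>) * (cis (- (x * \<xi>)) * f x)" for x
  have cf: "continuous_on UNIV f"
    using d by (intro continuous_at_imp_continuous_on) (auto intro: has_vector_derivative_continuous)
  have iw: "integrable lborel w" unfolding w_def
    using f f' by (intro Bochner_Integration.integrable_diff integrable_mult_right integrable_cis_mult) auto
  have "(LBINT x=-\<infinity>..\<infinity>. w x) = 0 - 0"
  proof (rule interval_integral_FTC_integrable)
    show "(W has_vector_derivative w x) (at x)" for x
    proof -
      have "((\<lambda>x. - (x * \<xi>)) has_derivative (\<lambda>h. h * - \<xi>)) (at x)"
        by (auto intro!: derivative_eq_intros)
      from has_derivative_cis[OF this]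
      have "((\<lambda>x. cis (- (x * \<xi>))) has_vector_derivative (- \<xi>) *\<^sub>R (\<i> * cis (- (x * \<xi>)))) (at x)"
        by (simp add: has_vector_derivative_def)
      from has_vector_derivative_mult[OF this d] show ?thesis
        unfolding W_def[abs_def] by (rule has_vector_derivative_eq_rhs) (simp add: w_def scaleR_conv_of_real)
    qed
    have "continuous_on UNIV w" unfolding w_def by (intro continuous_intros c cf)
    then show "isCont w x" for x by (simp add: continuous_on_eq_continuous_at)
    show "set_integrable lborel (einterval (- \<infinity>) \<infinity>) w" using iw by (simp add: set_integrable_def einterval_eq)
    have lW: "(W \<longlongrightarrow> 0) G" if "(f \<longlongrightarrow> 0) G" for G
      using tendsto_norm_zero[OF that] by (intro tendsto_norm_zero_cancel[of W]) (simp add: W_def norm_mult)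
    show "((W \<circ> real_of_ereal) \<longlongrightarrow> 0) (at_right (- \<infinity>))" "((W \<circ> real_of_ereal) \<longlongrightarrow> 0) (at_left \<infinity>)"
      using lW lim by (simp_all add: ereal_tendsto_simps)
  qed simp
  then have "(LINT x|lborel. w x) = 0"
    by (simp add: interval_lebesgue_integral_def set_lebesgue_integral_def einterval_eq)
  moreover have "(LINT x|lborel. w x) = fourier f' \<xi> - \<i> * of_real \<xi> * fourier f \<xi>"
    unfolding w_def fourier_def using f f'
    by (subst Bochner_Integration.integral_diff) (auto intro!: integrable_cis_mult integrable_mult_right)
  ultimately show ?thesis by simp
qed

text \<open>This is Fubini's theorem. It serves twice below: to evaluate the regularized inversion
  of \<open>fourier f\<close>, and to carry the weighted square integral of \<open>fourier f\<close>
  back to physical space.\<close>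

lemma fourier_multiplication:
  assumes a: "integrable lborel a" and b: "integrable lborel b"
  shows "(LINT \<xi>|lborel. a \<xi> * fourier b \<xi>) = (LINT x|lborel. b x * fourier a x)"
proof -
  have [measurable]: "a \<in> borel_measurable borel" "b \<in> borel_measurable borel"
    using borel_measurable_integrable[OF a] borel_measurable_integrable[OF b] by auto
  have "integrable (lborel \<Otimes>\<^sub>M lborel) (\<lambda>(\<xi>, x). a \<xi> * (cis (- (x * \<xi>)) * b x))"
  proof (rule lborel_pair.Fubini_integrable)
    show "integrable lborel (\<lambda>\<xi>. LINT x|lborel. norm (case (\<xi>, x) of (\<xi>, x) \<Rightarrow> a \<xi> * (cis (- (x * \<xi>)) * b x)))"
      using a by (simp add: norm_mult)
    show "AE \<xi> in lborel. integrable lborel (\<lambda>x. case (\<xi>, x) of (\<xi>, x) \<Rightarrow> a \<xi> * (cis (- (x * \<xi>)) * b x))"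
      using b by simp
  qed measurable
  from lborel_pair.Fubini_integral[OF this]
  have "(LINT \<xi>|lborel. LINT x|lborel. a \<xi> * (cis (- (x * \<xi>)) * b x))
      = (LINT x|lborel. LINT \<xi>|lborel. a \<xi> * (cis (- (x * \<xi>)) * b x))" by simp
  moreover have "(LINT \<xi>|lborel. a \<xi> * (cis (- (x * \<xi>)) * b x)) = b x * fourier a x" for x
  proof -
    have "(LINT \<xi>|lborel. a \<xi> * (cis (- (x * \<xi>)) * b x)) = (LINT \<xi>|lborel. b x * (cis (- (\<xi> * x)) * a \<xi>))"
      by (simp add: mult_ac)
    then show ?thesis by (simp add: fourier_def)
  qed
  ultimately show ?thesis by (simp add: fourier_def)
qed

section \<open>Gaussian regularization and the square-mean bound\<close>

lemma integrable_gaussian: "\<epsilon> > 0 \<Longrightarrow> integrable lborel (\<lambda>\<xi>::real. exp (- (\<epsilon> * \<xi>)\<^sup>2 / 2))"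
proof -
  assume "\<epsilon> > 0"
  have "integrable lborel (\<lambda>\<xi>::real. exp (- \<xi>\<^sup>2 / 2))"
    using integrable_mult_right[OF integrable_normal_density[of 1 0], of "sqrt (2 * pi)"]
    by (simp add: std_normal_density_def)
  from lborel_integrable_real_affine[OF this, of \<epsilon> 0] \<open>\<epsilon> > 0\<close> show ?thesis by simp
qed

text \<open>After rescaling by \<open>\<epsilon>\<close> this is the characteristic function of the
  standard normal law at \<open>v = (y - x) / \<epsilon>\<close>; the rest matches normalizing
  constants.\<close>

lemma fourier_gaussian:
  assumes e: "\<epsilon> > 0"
  shows "fourier (\<lambda>\<xi>. of_real (exp (- (\<epsilon> * \<xi>)\<^sup>2 / 2)) * cis (y * \<xi>)) x = of_real (2 * pi * normal_density y \<epsilon> x)"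
proof -
  define v where "v = (y - x) / \<epsilon>"
  have "of_real (exp (- v\<^sup>2 / 2)) = char std_normal_distribution v"
    by (simp add: char_std_normal_distribution)
  also have "\<dots> = (LINT s|lborel. std_normal_density s *\<^sub>R cis (v * s))"
    unfolding char_def cis_conv_exp[symmetric]
    by (subst integral_density) (auto simp: normal_density_nonneg)
  also have "\<dots> = \<epsilon> *\<^sub>R (LINT \<xi>|lborel. std_normal_density (\<epsilon> * \<xi>) *\<^sub>R cis (v * (\<epsilon> * \<xi>)))"
    using lborel_integral_real_affine[of \<epsilon> "\<lambda>s. std_normal_density s *\<^sub>R cis (v * s)" 0] e by simp
  also have "(LINT \<xi>|lborel. std_normal_density (\<epsilon> * \<xi>) *\<^sub>R cis (v * (\<epsilon> * \<xi>)))
      = (LINT \<xi>|lborel. (1 / sqrt (2 * pi)) *\<^sub>R (cis (- (\<xi> * x)) * (of_real (exp (- (\<epsilon> * \<xi>)\<^sup>2 / 2)) * cis (y * \<xi>))))"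
  proof (rule Bochner_Integration.integral_cong[OF refl])
    fix \<xi>
    have "v * (\<epsilon> * \<xi>) = - (\<xi> * x) + y * \<xi>" using e by (simp add: v_def field_simps)
    then have "cis (v * (\<epsilon> * \<xi>)) = cis (- (\<xi> * x)) * cis (y * \<xi>)" by (simp add: cis_mult)
    then show "std_normal_density (\<epsilon> * \<xi>) *\<^sub>R cis (v * (\<epsilon> * \<xi>))
      = (1 / sqrt (2 * pi)) *\<^sub>R (cis (- (\<xi> * x)) * (of_real (exp (- (\<epsilon> * \<xi>)\<^sup>2 / 2)) * cis (y * \<xi>)))"
      by (simp add: std_normal_density_def scaleR_conv_of_real mult_ac)
  qed
  also have "\<dots> = (1 / sqrt (2 * pi)) *\<^sub>R fourier (\<lambda>\<xi>. of_real (exp (- (\<epsilon> * \<xi>)\<^sup>2 / 2)) * cis (y * \<xi>)) x"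
    unfolding fourier_def by (rule integral_scaleR_right)
  finally have "of_real (exp (- v\<^sup>2 / 2))
      = (\<epsilon> / sqrt (2 * pi)) *\<^sub>R fourier (\<lambda>\<xi>. of_real (exp (- (\<epsilon> * \<xi>)\<^sup>2 / 2)) * cis (y * \<xi>)) x" by simp
  then have "fourier (\<lambda>\<xi>. of_real (exp (- (\<epsilon> * \<xi>)\<^sup>2 / 2)) * cis (y * \<xi>)) x
      = (sqrt (2 * pi) / \<epsilon>) *\<^sub>R of_real (exp (- v\<^sup>2 / 2))"
    using e by simp
  also have "\<dots> = of_real (sqrt (2 * pi) / \<epsilon> * exp (- v\<^sup>2 / 2))" by (simp add: scaleR_conv_of_real)
  also have "sqrt (2 * pi) / \<epsilon> * exp (- v\<^sup>2 / 2) = 2 * pi * normal_density y \<epsilon> x"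
  proof -
    have "v\<^sup>2 / 2 = (x - y)\<^sup>2 / (2 * \<epsilon>\<^sup>2)" by (simp add: v_def power_divide power2_commute)
    moreover have "sqrt (2 * pi) / \<epsilon> = 2 * pi * (1 / sqrt (2 * pi * \<epsilon>\<^sup>2))"
    proof -
      have "2 * pi = sqrt (2 * pi) * sqrt (2 * pi)" by simp
      moreover have "sqrt (2 * pi * \<epsilon>\<^sup>2) = sqrt (2 * pi) * \<epsilon>" using e by (simp add: real_sqrt_mult)
      ultimately show ?thesis using e by (simp add: field_simps)
    qed
    ultimately show ?thesis by (simp add: normal_density_def)
  qed
  finally show ?thesis .
qed

text \<open>If \<open>f\<close> is not integrable, its Bochner integral takes the default value 0
  and the inequality is trivial.\<close>

lemma ennreal_norm_integral_le: "ennreal (norm (integral\<^sup>L M f)) \<le> (\<integral>\<^sup>+x. norm (f x) \<partial>M)"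
  by (cases "integrable M f") (auto intro: integral_norm_bound_ennreal simp: not_integrable_integral_eq)

lemma normal_density_commute: "normal_density x \<sigma> y = normal_density y \<sigma> x"
  by (simp add: normal_density_def power2_commute)

lemma nn_integral_normal_density: "\<sigma> > 0 \<Longrightarrow> (\<integral>\<^sup>+x. normal_density \<mu> \<sigma> x \<partial>lborel) = 1"
  by (subst nn_integral_eq_integral) (auto simp: normal_density_nonneg)

text \<open>Half of Plancherel's theorem suffices. The Gaussian weight makes Fubini applicable and turns the
  left-hand side into a convolution form with a nonnegative kernel of mass \<open>2 \<pi>\<close>.\<close>

lemma gaussian_weighted_fourier_bound:
  assumes f: "integrable lborel f" and f2: "integrable lborel (\<lambda>x. (norm (f x))\<^sup>2)" and e: "\<epsilon> > 0"
  shows "(\<integral>\<^sup>+\<xi>. ennreal (exp (- (\<epsilon> * \<xi>)\<^sup>2 / 2) * (norm (fourier f \<xi>))\<^sup>2) \<partial>lborel)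
    \<le> ennreal (2 * pi * (LINT x|lborel. (norm (f x))\<^sup>2))"
proof -
  have [measurable]: "f \<in> borel_measurable borel" using borel_measurable_integrable[OF f] by simp
  define g :: "real \<Rightarrow> real" where "g \<xi> = exp (- (\<epsilon> * \<xi>)\<^sup>2 / 2)" for \<xi>
  define k where "k x z = normal_density x \<epsilon> z" for x z
  have [measurable]: "g \<in> borel_measurable borel" unfolding g_def by measurable
  have [measurable]: "case_prod k \<in> borel_measurable (borel \<Otimes>\<^sub>M borel)"
    unfolding k_def normal_density_def by measurable
  have k0: "k x z \<ge> 0" for x z by (simp add: k_def)
  have ig: "integrable lborel g" unfolding g_def[abs_def] by (rule integrable_gaussian[OF e])
  have ib: "integrable lborel (\<lambda>\<xi>. of_real (g \<xi>) * h \<xi>)"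
    if [measurable]: "h \<in> borel_measurable borel" and h: "\<And>\<xi>. norm (h \<xi>) \<le> B" for h :: "real \<Rightarrow> complex" and B
  proof (rule Bochner_Integration.integrable_bound[OF integrable_mult_right[OF ig, of B]])
    have "norm (of_real (g \<xi>) * h \<xi>) \<le> norm (B * g \<xi>)" for \<xi>
    proof -
      have "B \<ge> 0" using order_trans[OF norm_ge_zero h] .
      then show ?thesis using mult_right_mono[OF h[of \<xi>], of "g \<xi>"] by (simp add: norm_mult g_def mult.commute)
    qed
    then show "AE \<xi> in lborel. norm (of_real (g \<xi>) * h \<xi>) \<le> norm (B * g \<xi>)" by simp
  qed measurable
  define Q where "Q = (LINT x|lborel. norm (f x))"
  \<comment> \<open>\<open>J\<close> is \<open>2 * pi\<close> times the convolution of
    \<open>f\<close> with a Gaussian density of width \<open>\<epsilon>\<close>; it equals the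
    Gaussian-weighted inversion integral of \<open>fourier f\<close>.\<close>
  define J where "J x = (LINT z|lborel. f z * of_real (2 * pi * k x z))" for x
  have J: "(LINT \<xi>|lborel. of_real (g \<xi>) * cis (x * \<xi>) * fourier f \<xi>) = J x" for x
  proof -
    have "integrable lborel (\<lambda>\<xi>. of_real (g \<xi>) * cis (x * \<xi>))" by (rule ib[of _ 1]) auto
    from fourier_multiplication[OF this f] show ?thesis
      using fourier_gaussian[OF e, of x] by (simp add: J_def k_def g_def)
  qed
  \<comment> \<open>Against \<open>fourier f\<close>, this function integrates to the weighted
    square integral; the multiplication formula then turns it into the pairing of \<open>f\<close>
    with \<open>cnj (J x)\<close>.\<close>
  define a where "a \<xi> = of_real (g \<xi>) * cnj (fourier f \<xi>)" for \<xi>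
  have [measurable]: "cnj \<in> borel_measurable borel"
    by (intro borel_measurable_continuous_onI continuous_intros)
  have ia: "integrable lborel a" unfolding a_def
    by (rule ib[of _ Q]) (auto simp: Q_def norm_fourier_le)
  have Fa: "fourier a x = cnj (J x)" for x
    unfolding J[symmetric] fourier_def[of a] Bochner_Integration.integral_cnj[symmetric]
    by (intro Bochner_Integration.integral_cong) (auto simp: a_def cis_cnj mult_ac)
  have wf: "complex_of_real (g \<xi> * (norm (fourier f \<xi>))\<^sup>2) = a \<xi> * fourier f \<xi>" for \<xi>
    unfolding a_def of_real_mult complex_norm_square by (simp add: mult_ac)
  have iw: "integrable lborel (\<lambda>\<xi>. g \<xi> * (norm (fourier f \<xi>))\<^sup>2)"
  proof (rule Bochner_Integration.integrable_bound[OF integrable_mult_right[OF ig, of "Q\<^sup>2"]])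
    have "norm (g \<xi> * (norm (fourier f \<xi>))\<^sup>2) \<le> norm (Q\<^sup>2 * g \<xi>)" for \<xi>
      using power_mono[OF norm_fourier_le[of f \<xi>], of 2] by (simp add: Q_def g_def abs_mult mult.commute)
    then show "AE \<xi> in lborel. norm (g \<xi> * (norm (fourier f \<xi>))\<^sup>2) \<le> norm (Q\<^sup>2 * g \<xi>)" by simp
  qed measurable
  have "of_real (LINT \<xi>|lborel. g \<xi> * (norm (fourier f \<xi>))\<^sup>2) = (LINT \<xi>|lborel. a \<xi> * fourier f \<xi>)"
    by (subst integral_complex_of_real[symmetric]) (simp only: wf)
  also have "\<dots> = (LINT x|lborel. f x * cnj (J x))"
    using fourier_multiplication[OF ia f] by (simp only: Fa)
  finally have "\<bar>LINT \<xi>|lborel. g \<xi> * (norm (fourier f \<xi>))\<^sup>2\<bar> = norm (LINT x|lborel. f x * cnj (J x))"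
    by (metis norm_of_real)
  then have LJ: "(LINT \<xi>|lborel. g \<xi> * (norm (fourier f \<xi>))\<^sup>2) \<le> norm (LINT x|lborel. f x * cnj (J x))"
    by linarith
  have "(\<integral>\<^sup>+\<xi>. ennreal (g \<xi> * (norm (fourier f \<xi>))\<^sup>2) \<partial>lborel)
      = ennreal (LINT \<xi>|lborel. g \<xi> * (norm (fourier f \<xi>))\<^sup>2)"
    by (rule nn_integral_eq_integral[OF iw]) (simp add: g_def)
  also have "\<dots> \<le> ennreal (norm (LINT x|lborel. f x * cnj (J x)))" by (rule ennreal_leI[OF LJ])
  also have "\<dots> \<le> (\<integral>\<^sup>+x. norm (f x * cnj (J x)) \<partial>lborel)" by (rule ennreal_norm_integral_le)
  also have "\<dots> \<le> (\<integral>\<^sup>+x. (\<integral>\<^sup>+z. ennreal (pi * (norm (f x))\<^sup>2) * ennreal (k x z) \<partial>lborel)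
      + (\<integral>\<^sup>+z. ennreal (pi * (norm (f z))\<^sup>2) * ennreal (k x z) \<partial>lborel) \<partial>lborel)"
  proof (rule nn_integral_mono)
    fix x
    have "ennreal (norm (f x * cnj (J x))) = ennreal (norm (f x)) * ennreal (norm (J x))"
      by (simp add: norm_mult ennreal_mult')
    also have "\<dots> \<le> ennreal (norm (f x)) * (\<integral>\<^sup>+z. norm (f z * of_real (2 * pi * k x z)) \<partial>lborel)"
      unfolding J_def by (intro mult_left_mono ennreal_norm_integral_le) simp
    also have "\<dots> = (\<integral>\<^sup>+z. ennreal (norm (f x)) * norm (f z * of_real (2 * pi * k x z)) \<partial>lborel)"
      by (rule nn_integral_cmult[symmetric]) measurable
    also have "\<dots> \<le> (\<integral>\<^sup>+z. ennreal (pi * (norm (f x))\<^sup>2) * ennreal (k x z)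
        + ennreal (pi * (norm (f z))\<^sup>2) * ennreal (k x z) \<partial>lborel)"
    proof (rule nn_integral_mono)
      fix z
      \<comment> \<open>Bounding \<open>2 * norm (f x) * norm (f z)\<close> by the sum of squares
        leaves each square integrated against a kernel of mass one in the other variable.\<close>
      have "norm (f x) * norm (f z * of_real (2 * pi * k x z)) = (2 * norm (f x) * norm (f z)) * (pi * k x z)"
        using k0[of x z] by (simp add: norm_mult)
      also have "\<dots> \<le> ((norm (f x))\<^sup>2 + (norm (f z))\<^sup>2) * (pi * k x z)"
        using k0[of x z] by (intro mult_right_mono sum_squares_bound) auto
      finally have "ennreal (norm (f x) * norm (f z * of_real (2 * pi * k x z)))
          \<le> ennreal (pi * (norm (f x))\<^sup>2 * k x z + pi * (norm (f z))\<^sup>2 * k x z)"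
        by (intro ennreal_leI) (simp add: algebra_simps)
      then show "ennreal (norm (f x)) * norm (f z * of_real (2 * pi * k x z))
          \<le> ennreal (pi * (norm (f x))\<^sup>2) * ennreal (k x z) + ennreal (pi * (norm (f z))\<^sup>2) * ennreal (k x z)"
        unfolding ennreal_mult''[OF k0, symmetric] ennreal_mult''[OF norm_ge_zero, symmetric]
        by (subst ennreal_plus[symmetric]) (use k0[of x z] in auto)
    qed
    also have "\<dots> = (\<integral>\<^sup>+z. ennreal (pi * (norm (f x))\<^sup>2) * ennreal (k x z) \<partial>lborel)
        + (\<integral>\<^sup>+z. ennreal (pi * (norm (f z))\<^sup>2) * ennreal (k x z) \<partial>lborel)"
      by (rule nn_integral_add) measurable
    finally show "ennreal (norm (f x * cnj (J x))) \<le> \<dots>" .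
  qed
  also have "\<dots> = (\<integral>\<^sup>+x. \<integral>\<^sup>+z. ennreal (pi * (norm (f x))\<^sup>2) * ennreal (k x z) \<partial>lborel \<partial>lborel)
      + (\<integral>\<^sup>+x. \<integral>\<^sup>+z. ennreal (pi * (norm (f z))\<^sup>2) * ennreal (k x z) \<partial>lborel \<partial>lborel)"
    by (rule nn_integral_add) measurable
  also have "(\<integral>\<^sup>+x. \<integral>\<^sup>+z. ennreal (pi * (norm (f z))\<^sup>2) * ennreal (k x z) \<partial>lborel \<partial>lborel)
      = (\<integral>\<^sup>+z. \<integral>\<^sup>+x. ennreal (pi * (norm (f z))\<^sup>2) * ennreal (k z x) \<partial>lborel \<partial>lborel)"
  proof -
    \<comment> \<open>Symmetry of the kernel identifies the second double integral with the
      first.\<close>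
    have comm: "k x z = k z x" for x z unfolding k_def by (rule normal_density_commute)
    have "(\<integral>\<^sup>+x. \<integral>\<^sup>+z. ennreal (pi * (norm (f z))\<^sup>2) * ennreal (k x z) \<partial>lborel \<partial>lborel)
        = (\<integral>\<^sup>+z. \<integral>\<^sup>+x. ennreal (pi * (norm (f z))\<^sup>2) * ennreal (k x z) \<partial>lborel \<partial>lborel)"
      by (rule lborel_pair.Fubini') measurable
    also have "\<dots> = (\<integral>\<^sup>+z. \<integral>\<^sup>+x. ennreal (pi * (norm (f z))\<^sup>2) * ennreal (k z x) \<partial>lborel \<partial>lborel)"
      by (intro nn_integral_cong) (subst comm, rule refl)
    finally show ?thesis .
  qed
  also have "(\<integral>\<^sup>+x. \<integral>\<^sup>+z. ennreal (pi * (norm (f x))\<^sup>2) * ennreal (k x z) \<partial>lborel \<partial>lborel)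
      = ennreal (pi * (LINT x|lborel. (norm (f x))\<^sup>2))"
  proof -
    have "(\<integral>\<^sup>+z. ennreal (pi * (norm (f x))\<^sup>2) * ennreal (k x z) \<partial>lborel) = ennreal (pi * (norm (f x))\<^sup>2)" for x
      using nn_integral_normal_density[OF e, of x] by (subst nn_integral_cmult) (auto simp: k_def)
    then show ?thesis
      using nn_integral_eq_integral[OF integrable_mult_right[OF f2, of pi]] by simp
  qed
  also have "ennreal (pi * (LINT x|lborel. (norm (f x))\<^sup>2)) + ennreal (pi * (LINT x|lborel. (norm (f x))\<^sup>2))
      = ennreal (2 * pi * (LINT x|lborel. (norm (f x))\<^sup>2))"
    by (subst ennreal_plus[symmetric]) auto
  finally show ?thesis by (simp add: g_def)
qed

text \<open>Along \<open>\<epsilon> = 1 / Suc n\<close> the Gaussian weight tends to 1, and Fatou's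
  lemma gives finiteness and the bound together. The factor \<open>2 * pi\<close> reflects the
  unnormalized transform.\<close>

lemma fourier_L2_bound:
  assumes f: "integrable lborel f" and f2: "integrable lborel (\<lambda>x. (norm (f x))\<^sup>2)"
  shows "integrable lborel (\<lambda>\<xi>. (norm (fourier f \<xi>))\<^sup>2)"
    and "(LINT \<xi>|lborel. (norm (fourier f \<xi>))\<^sup>2) \<le> 2 * pi * (LINT x|lborel. (norm (f x))\<^sup>2)"
proof -
  have [measurable]: "f \<in> borel_measurable borel" using borel_measurable_integrable[OF f] by simp
  define h where "h n \<xi> = ennreal (exp (- (1 / real (Suc n) * \<xi>)\<^sup>2 / 2) * (norm (fourier f \<xi>))\<^sup>2)" for n \<xi>
  define N where "N = 2 * pi * (LINT x|lborel. (norm (f x))\<^sup>2)"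
  have N: "N \<ge> 0" by (simp add: N_def)
  have lim: "(\<lambda>n. h n \<xi>) \<longlonglongrightarrow> ennreal ((norm (fourier f \<xi>))\<^sup>2)" for \<xi>
  proof -
    have "(\<lambda>n. 1 / real (Suc n)) \<longlonglongrightarrow> 0" using LIMSEQ_Suc[OF lim_inverse_n'] by simp
    then have "(\<lambda>n. exp (- (1 / real (Suc n) * \<xi>)\<^sup>2 / 2) * (norm (fourier f \<xi>))\<^sup>2)
        \<longlonglongrightarrow> exp (- (0 * \<xi>)\<^sup>2 / 2) * (norm (fourier f \<xi>))\<^sup>2"
      by (intro tendsto_intros) auto
    then show ?thesis unfolding h_def by (intro tendsto_ennrealI) simp
  qed
  have "(\<integral>\<^sup>+\<xi>. ennreal ((norm (fourier f \<xi>))\<^sup>2) \<partial>lborel) = (\<integral>\<^sup>+\<xi>. liminf (\<lambda>n. h n \<xi>) \<partial>lborel)"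
    using lim_imp_Liminf[OF _ lim] by (intro nn_integral_cong) simp
  also have "\<dots> \<le> liminf (\<lambda>n. \<integral>\<^sup>+\<xi>. h n \<xi> \<partial>lborel)"
    by (rule nn_integral_liminf) (simp add: h_def)
  also have "\<dots> \<le> ennreal N"
    unfolding h_def N_def
    by (intro Liminf_le always_eventually allI gaussian_weighted_fourier_bound[OF f f2]) auto
  finally have le: "(\<integral>\<^sup>+\<xi>. ennreal ((norm (fourier f \<xi>))\<^sup>2) \<partial>lborel) \<le> ennreal N" .
  show i: "integrable lborel (\<lambda>\<xi>. (norm (fourier f \<xi>))\<^sup>2)"
    by (rule integrableI_nonneg) (use le in \<open>auto intro: le_less_trans\<close>)
  from le have "ennreal (LINT \<xi>|lborel. (norm (fourier f \<xi>))\<^sup>2) \<le> ennreal N"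
    by (subst (asm) nn_integral_eq_integral[OF i]) auto
  then show "(LINT \<xi>|lborel. (norm (fourier f \<xi>))\<^sup>2) \<le> 2 * pi * (LINT x|lborel. (norm (f x))\<^sup>2)"
    using N by (simp add: N_def[symmetric])
qed

section \<open>Schwartz functions\<close>

text \<open>The two bounds add up to \<open>(1 + x\<^sup>2) * norm (f x) \<le> B + B'\<close>, an
  integrable majorant; boundedness of \<open>f\<close> then covers the square.\<close>

lemma integrable_quadratic_decay:
  fixes f :: "real \<Rightarrow> complex"
  assumes c: "continuous_on UNIV f" and b0: "bounded (range f)" and b2: "bounded (range (\<lambda>x. x\<^sup>2 *\<^sub>R f x))"
  shows "integrable lborel f" and "integrable lborel (\<lambda>x. (norm (f x))\<^sup>2)"
proof -
  have [measurable]: "f \<in> borel_measurable borel" using c by (rule borel_measurable_continuous_onI)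
  obtain B where B: "norm (f x) \<le> B" for x using b0 by (auto simp: bounded_iff)
  obtain B' where B': "norm (x\<^sup>2 *\<^sub>R f x) \<le> B'" for x using b2 by (auto simp: bounded_iff)
  note hq = has_bochner_integral_inverse_one_plus_square
  have iq: "integrable lborel (\<lambda>x. (B + B') * (1 / (1 + x\<^sup>2)))"
    by (intro integrable_mult_right integrable.intros[OF hq])
  have "norm (f x) \<le> (B + B') * (1 / (1 + x\<^sup>2))" for x
  proof -
    have "(1 + x\<^sup>2) * norm (f x) \<le> B + B'" using B[of x] B'[of x] by (simp add: distrib_right)
    moreover have "1 + x\<^sup>2 > 0" by (simp add: add_pos_nonneg)
    ultimately show ?thesis by (simp add: field_simps)
  qed
  then have le: "norm (f x) \<le> norm ((B + B') * (1 / (1 + x\<^sup>2)))" for x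
    using order_trans abs_ge_self unfolding real_norm_def by blast
  show i: "integrable lborel f"
    by (rule Bochner_Integration.integrable_bound[OF iq]) (use le in auto)
  have "norm ((norm (f x))\<^sup>2) \<le> norm (B * norm (f x))" for x
    using mult_right_mono[OF B[of x] norm_ge_zero[of "f x"]] order_trans[OF norm_ge_zero B[of x]]
    by (simp add: power2_eq_square abs_mult)
  then show "integrable lborel (\<lambda>x. (norm (f x))\<^sup>2)"
    by (intro Bochner_Integration.integrable_bound[OF integrable_mult_right[OF integrable_norm[OF i], of B]]) auto
qed

lemma tendsto_zero_linear_decay:
  fixes f :: "real \<Rightarrow> complex"
  assumes b: "bounded (range (\<lambda>x. x *\<^sub>R f x))"
  shows "(f \<longlongrightarrow> 0) at_infinity"
proof -
  obtain B where B: "norm (x *\<^sub>R f x) \<le> B" for x using b by (auto simp: bounded_iff)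
  show ?thesis
  proof (rule Lim_null_comparison)
    show "((\<lambda>x::real. B * norm (inverse x)) \<longlongrightarrow> 0) at_infinity"
      by (intro tendsto_mult_right_zero tendsto_norm_zero tendsto_inverse_0)
    show "\<forall>\<^sub>F x in at_infinity. norm (f x) \<le> B * norm (inverse x)"
      unfolding eventually_at_infinity
    proof (intro exI[of _ 1] allI impI)
      fix x :: real assume "1 \<le> norm x"
      then show "norm (f x) \<le> B * norm (inverse x)" using B[of x] by (simp add: field_simps)
    qed
  qed
qed

lemma schwartz_has_vector_derivative:
  assumes "f \<in> schwartz"
  shows "((deriv_x ^^ n) f has_vector_derivative (deriv_x ^^ Suc n) f x) (at x)"
  using assms unfolding schwartz_def by (auto simp: deriv_x_def vector_derivative_works[symmetric])

lemma schwartz_continuous: "f \<in> schwartz \<Longrightarrow> continuous_on UNIV ((deriv_x ^^ n) f)"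
  by (intro continuous_at_imp_continuous_on ballI
      has_vector_derivative_continuous[OF schwartz_has_vector_derivative])

lemma schwartz_bounded: "f \<in> schwartz \<Longrightarrow> bounded (range (\<lambda>x. x ^ m *\<^sub>R (deriv_x ^^ n) f x))"
  unfolding schwartz_def by blast

lemma schwartz_integrable:
  assumes "f \<in> schwartz"
  shows "integrable lborel (\<lambda>x. x ^ m *\<^sub>R (deriv_x ^^ n) f x)"
    and "integrable lborel (\<lambda>x. (norm (x ^ m *\<^sub>R (deriv_x ^^ n) f x))\<^sup>2)"
proof -
  have c: "continuous_on UNIV (\<lambda>x. x ^ m *\<^sub>R (deriv_x ^^ n) f x)"
    by (intro continuous_intros schwartz_continuous assms)
  \<comment> \<open>The extra decay factor \<open>x\<^sup>2\<close> is absorbed into the seminorm of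
    order \<open>2 + m\<close>.\<close>
  have "bounded (range (\<lambda>x. x\<^sup>2 *\<^sub>R x ^ m *\<^sub>R (deriv_x ^^ n) f x))"
    using schwartz_bounded[OF assms, of "2 + m" n] by (simp only: scaleR_scaleR power_add)
  note d = integrable_quadratic_decay[OF c schwartz_bounded[OF assms] this]
  show "integrable lborel (\<lambda>x. x ^ m *\<^sub>R (deriv_x ^^ n) f x)"
    "integrable lborel (\<lambda>x. (norm (x ^ m *\<^sub>R (deriv_x ^^ n) f x))\<^sup>2)" by (rule d)+
qed

text \<open>Multiplication by \<open>s\<close> turns \<open>fourier \<phi>\<close> into
  \<open>- \<i> * fourier (deriv_x \<phi>)\<close>, and differentiation in \<open>s\<close> inserts
  \<open>- \<i> * x\<close> under the transform, which yields the stated second function. The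
  factors \<open>2 * pi\<close> in the hypotheses are those of
  \<open>fourier_L2_bound\<close>.\<close>

lemma schwartz_fourier_profile:
  assumes \<phi>: "\<phi> \<in> schwartz" and K: "K > 0"
    and n0: "2 * pi * (L2_norm \<phi>)\<^sup>2 \<le> K\<^sup>2" and n1: "2 * pi * (L2_norm (deriv_x \<phi>))\<^sup>2 \<le> K\<^sup>2"
    and n2: "2 * pi * (L2_norm (\<lambda>x. of_real x * deriv_x \<phi> x))\<^sup>2 \<le> K\<^sup>2"
  shows "fourier_profile (fourier \<phi>) (\<lambda>s. - fourier (\<lambda>x. of_real x * deriv_x \<phi> x) s) K"
proof -
  define h where "h x = complex_of_real x * deriv_x \<phi> x" for x
  have L2: "(L2_norm f)\<^sup>2 = (LINT x|lborel. (norm (f x))\<^sup>2)" for f by (simp add: L2_norm_def)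
  note i = schwartz_integrable[OF \<phi>]
  have i0: "integrable lborel \<phi>" "integrable lborel (\<lambda>x. x *\<^sub>R \<phi> x)" "integrable lborel (\<lambda>x. x\<^sup>2 *\<^sub>R \<phi> x)"
    "integrable lborel (\<lambda>x. (norm (\<phi> x))\<^sup>2)"
    using i(1)[of 0 0] i(1)[of 1 0] i(1)[of 2 0] i(2)[of 0 0] by simp_all
  have i1: "integrable lborel (deriv_x \<phi>)" "integrable lborel (\<lambda>x. x *\<^sub>R deriv_x \<phi> x)"
    "integrable lborel (\<lambda>x. x\<^sup>2 *\<^sub>R deriv_x \<phi> x)" "integrable lborel (\<lambda>x. (norm (deriv_x \<phi> x))\<^sup>2)"
    using i(1)[of 0 1] i(1)[of 1 1] i(1)[of 2 1] i(2)[of 0 1] by simp_all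
  \<comment> \<open>Continuity of \<open>fourier h\<close> is obtained from its differentiability,
    which uses the second moment of \<open>h\<close> and hence \<open>x ^ 3\<close> times the
    derivative of \<open>\<phi>\<close>.\<close>
  have ih: "integrable lborel h" "integrable lborel (\<lambda>x. x *\<^sub>R h x)"
    "integrable lborel (\<lambda>x. x\<^sup>2 *\<^sub>R h x)" "integrable lborel (\<lambda>x. (norm (h x))\<^sup>2)"
    using i(1)[of 1 1] i(1)[of 2 1] i(1)[of 3 1] i(2)[of 1 1]
    by (simp_all add: h_def[abs_def] scaleR_conv_of_real power2_eq_square power3_eq_cube mult.assoc)
  have cont: "continuous_on UNIV (fourier f)"
    if "integrable lborel f" "integrable lborel (\<lambda>x. x *\<^sub>R f x)" "integrable lborel (\<lambda>x. x\<^sup>2 *\<^sub>R f x)" for f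
    using fourier_has_vector_derivative[OF that]
    by (intro continuous_at_imp_continuous_on) (auto intro: has_vector_derivative_continuous)
  have d\<phi>: "(\<phi> has_vector_derivative deriv_x \<phi> x) (at x)" for x
    using schwartz_has_vector_derivative[OF \<phi>, of 0] by simp
  have lim: "(\<phi> \<longlongrightarrow> 0) at_infinity"
    using tendsto_zero_linear_decay schwartz_bounded[OF \<phi>, of 1 0] by simp
  have "fourier (deriv_x \<phi>) s = \<i> * of_real s * fourier \<phi> s" for s
  proof (rule fourier_deriv[OF d\<phi> _ i0(1) i1(1)])
    show "continuous_on UNIV (deriv_x \<phi>)" using schwartz_continuous[OF \<phi>, of 1] by simp
    show "(\<phi> \<longlongrightarrow> 0) at_top" "(\<phi> \<longlongrightarrow> 0) at_bot"
      using lim by (auto intro: tendsto_mono[OF at_top_le_at_infinity] tendsto_mono[OF at_bot_le_at_infinity])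
  qed
  then have G: "s *\<^sub>R fourier \<phi> s = - \<i> * fourier (deriv_x \<phi>) s" for s by (simp add: scaleR_conv_of_real flip: mult.assoc)
  then have nG: "norm (s *\<^sub>R fourier \<phi> s) = norm (fourier (deriv_x \<phi>) s)" for s by (simp only: norm_mult) simp
  have "fourier_profile (fourier \<phi>) (\<lambda>s. - fourier h s) K"
  proof
    show "continuous_on UNIV (fourier \<phi>)" by (rule cont[OF i0(1,2,3)])
    show "continuous_on UNIV (\<lambda>s. - fourier h s)" by (intro continuous_intros cont[OF ih(1,2,3)])
    show "((\<lambda>s. s *\<^sub>R fourier \<phi> s) has_vector_derivative - fourier h s) (at s)" for s
    proof -
      have "((\<lambda>s. - \<i> * fourier (deriv_x \<phi>) s) has_vector_derivative - \<i> * (- \<i> * fourier (\<lambda>x. x *\<^sub>R deriv_x \<phi> x) s)) (at s)"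
        by (intro has_vector_derivative_mult_right fourier_has_vector_derivative i1)
      then show ?thesis unfolding G by (simp add: h_def[abs_def] scaleR_conv_of_real flip: mult.assoc)
    qed
    show "integrable lborel (\<lambda>s. (norm (fourier \<phi> s))\<^sup>2)" "(LINT s|lborel. (norm (fourier \<phi> s))\<^sup>2) \<le> K\<^sup>2"
      using fourier_L2_bound[OF i0(1,4)] n0 by (simp_all add: L2)
    show "integrable lborel (\<lambda>s. (norm (s *\<^sub>R fourier \<phi> s))\<^sup>2)" "(LINT s|lborel. (norm (s *\<^sub>R fourier \<phi> s))\<^sup>2) \<le> K\<^sup>2"
      unfolding nG using fourier_L2_bound[OF i1(1,4)] n1 by (simp_all add: L2)
    show "integrable lborel (\<lambda>s. (norm (- fourier h s))\<^sup>2)" "(LINT s|lborel. (norm (- fourier h s))\<^sup>2) \<le> K\<^sup>2"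
      using fourier_L2_bound[OF ih(1,4)] n2 by (simp_all add: L2 h_def[abs_def])
  qed (rule K)
  then show ?thesis by (simp add: h_def[abs_def])
qed

section \<open>The estimate in physical space\<close>

text \<open>Passing from a pointwise bound to a bound on \<open>esssup\<close> takes measurability
  of the propagator.\<close>

lemma measurable_propagator:
  assumes [measurable]: "\<Phi> \<in> borel_measurable borel" "f \<in> borel_measurable borel"
  shows "propagator \<Phi> t f \<in> borel_measurable borel"
  unfolding propagator_def inverse_fourier_def by measurable

theorem proposition3p1:
  fixes \<alpha> :: real and \<Phi> :: "real \<Rightarrow> real"
  assumes "1 / 3 < \<alpha>" and "\<alpha> < 1 / 2"
    and "\<And>\<xi>. \<Phi> \<xi> = \<bar>\<xi>\<bar> powr \<alpha>"
  shows "\<exists>C>0. \<forall>t. \<forall>\<phi>\<in>schwartz.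
    Linf_norm (propagator \<Phi> t \<phi>)
      \<le> ereal (C * (1 + \<bar>t\<bar>) powr (- 1 / 2) *
          (H1_norm \<phi> + L2_norm (\<lambda>x. of_real x * deriv_x \<phi> x)))"
proof (intro exI[of _ 5000] conjI allI ballI)
  fix t :: real and \<phi> assume \<phi>: "\<phi> \<in> schwartz"
  define S where "S = H1_norm \<phi> + L2_norm (\<lambda>x. of_real x * deriv_x \<phi> x)"
  define q where "q = (1 + \<bar>t\<bar>) powr (- 1 / 2)"
  have L0: "L2_norm f \<ge> 0" for f by (simp add: L2_norm_def)
  have H: "L2_norm \<phi> \<le> H1_norm \<phi>" "L2_norm (deriv_x \<phi>) \<le> H1_norm \<phi>"
    unfolding H1_norm_def by (auto intro: real_le_rsqrt)
  have \<Phi>: "\<Phi> = (\<lambda>\<xi>. \<bar>\<xi>\<bar> powr \<alpha>)" using assms(3) by auto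
  \<comment> \<open>The slack \<open>e\<close> is introduced because \<open>fourier_profile\<close>
    takes a strictly positive bound, while \<open>S\<close> vanishes for
    \<open>\<phi> = 0\<close>.\<close>
  have bound: "norm (propagator \<Phi> t \<phi> x) \<le> 5000 * q * S" for x
  proof (rule field_le_epsilon)
    fix e :: real assume e: "e > 0"
    \<comment> \<open>The increment is scaled so that
      \<open>5000 * q * T = 5000 * q * S + e\<close>.\<close>
    define T where "T = S + e / (5000 * q)"
    have q: "q > 0" by (simp add: q_def add_pos_nonneg)
    have T: "T > 0" "S \<le> T" using e q H L0[of \<phi>] L0[of "\<lambda>x. of_real x * deriv_x \<phi> x"]
      by (auto simp: T_def S_def intro!: add_nonneg_pos)
    have le: "2 * pi * (L2_norm f)\<^sup>2 \<le> (sqrt (2 * pi) * T)\<^sup>2" if "L2_norm f \<le> S" for f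
      using power_mono[of "L2_norm f" T 2] that L0[of f] T by (simp add: power_mult_distrib)
    \<comment> \<open>The bound carries the factor \<open>sqrt (2 * pi)\<close> from
      \<open>fourier_L2_bound\<close>; the \<open>1 / (2 * pi)\<close> of the inversion formula
      absorbs it below.\<close>
    interpret fourier_profile "fourier \<phi>" "\<lambda>s. - fourier (\<lambda>x. of_real x * deriv_x \<phi> x) s" "sqrt (2 * pi) * T"
      using T H L0[of \<phi>] L0[of "deriv_x \<phi>"] L0[of "\<lambda>x. of_real x * deriv_x \<phi> x"]
      by (intro schwartz_fourier_profile[OF \<phi>] le) (auto simp: S_def)
    have "propagator \<Phi> t \<phi> x = (1 / (2 * pi)) *\<^sub>R (LINT s|lborel. cis (x * s + t * \<bar>s\<bar> powr \<alpha>) * fourier \<phi> s)"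
      by (simp add: propagator_def inverse_fourier_def \<Phi> mult.assoc[symmetric] cis_mult)
    then have "norm (propagator \<Phi> t \<phi> x)
        = (1 / (2 * pi)) * norm (LINT s|lborel. cis (x * s + t * \<bar>s\<bar> powr \<alpha>) * fourier \<phi> s)" by simp
    also have "\<dots> \<le> (1 / (2 * pi)) * (5000 * (sqrt (2 * pi) * T) * q)"
      unfolding q_def using assms by (intro mult_left_mono dispersive_bound) auto
    also have "\<dots> = (5000 * q * T) * (sqrt (2 * pi) / (2 * pi))" by simp
    also have "\<dots> \<le> (5000 * q * T) * 1"
    proof (intro mult_left_mono)
      have "sqrt (2 * pi) \<le> 2 * pi"
        using pi_gt3 by (intro real_le_lsqrt) (auto simp: power2_eq_square)
      then show "sqrt (2 * pi) / (2 * pi) \<le> 1" by simp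
    qed (use q T in simp)
    also have "\<dots> = 5000 * q * S + e" using q by (simp add: T_def distrib_left)
    finally show "norm (propagator \<Phi> t \<phi> x) \<le> 5000 * q * S + e" .
  qed
  have "\<phi> \<in> borel_measurable borel"
    using schwartz_continuous[OF \<phi>, of 0] by (simp add: borel_measurable_continuous_onI)
  then have "propagator \<Phi> t \<phi> \<in> borel_measurable borel"
    by (intro measurable_propagator) (simp_all add: \<Phi>)
  then show "Linf_norm (propagator \<Phi> t \<phi>) \<le> ereal (5000 * (1 + \<bar>t\<bar>) powr (- 1 / 2) *
          (H1_norm \<phi> + L2_norm (\<lambda>x. of_real x * deriv_x \<phi> x)))"
    unfolding Linf_norm_def using bound by (intro esssup_I) (auto simp: S_def q_def)
qed simp

end
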